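(* Let $r\ge 1$, and let $(a(t))_{t\in\mathbb Z}$ and $(c_j(k))_{k\in\mathbb Z}$, $1\le j\le r$, be arbitrary sequences of nonzero complex numbers (generic, so that no denominators below vanish). Define lower-triangular matrices $f=(f_{\mathbf n\mathbf k})_{\mathbf n,\mathbf k\in\mathbb Z^r}$ and $g=(g_{\mathbf k\mathbf l})_{\mathbf k,\mathbf l\in\mathbb Z^r}$ by $$f_{\mathbf n\mathbf k}=\frac{\prod_{t=|\mathbf k|}^{|\mathbf n|-1}\Big\{\theta\big(a(t)c_1(k_1)\cdots c_r(k_r)\big)\prod_{j=1}^r\theta\big(a(t)/c_j(k_j)\big)\Big\}}{\prod_{i=1}^r\prod_{t=k_i+1}^{n_i}\Big\{\theta\big(c_i(t)c_1(k_1)\cdots c_r(k_r)\big)\prod_{j=1}^r\theta\big(c_i(t)/c_j(k_j)\big)\Big\}}\qquad(\mathbf n\ge\mathbf k)$$ and $$g_{\mathbf k\mathbf l}=\frac{\theta\big(a(|\mathbf l|)c_1(l_1)\cdots c_r(l_r)\big)}{\theta\big(a(|\mathbf k|)c_1(k_1)\cdots c_r(k_r)\big)}\prod_{1\le i<j\le r}\frac{\theta\big(c_i(l_i)/c_j(l_j)\big)}{\theta\big(c_i(k_i)/c_j(k_j)\big)}\prod_{j=1}^r\frac{c_j(l_j)^j\,\theta\big(a(|\mathbf l|)/c_j(l_j)\big)}{c_j(k_j)^j\,\theta\big(a(|\mathbf k|)/c_j(k_j)\big)}$$ $$\times\frac{\prod_{t=|\mathbf l|+1}^{|\mathbf k|}\Big\{\theta\big(a(t)c_1(k_1)\cdots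 c_r(k_r)\big)\prod_{j=1}^r\theta\big(a(t)/c_j(k_j)\big)\Big\}}{\prod_{i=1}^r\prod_{t=l_i}^{k_i-1}\Big\{\theta\big(c_i(t)c_1(k_1)\cdots c_r(k_r)\big)\prod_{j=1}^r\theta\big(c_i(t)/c_j(k_j)\big)\Big\}}\qquad(\mathbf k\ge\mathbf l),$$ all other entries being $0$. Then $f$ and $g$ are mutually inverse.
   Context: Fix a complex number $p$ with $|p|<1$. For $x\in\mathbb C\setminus\{0\}$ put $\theta(x)=\theta(x;p)=\prod_{j=0}^\infty(1-p^jx)(1-p^{j+1}/x)$. For $\mathbf k=(k_1,\dots,k_r)\in\mathbb Z^r$ write $|\mathbf k|=k_1+\cdots+k_r$; $\mathbf n\ge\mathbf k$ means $n_i\ge k_i$ for all $i$. A matrix $(f_{\mathbf n\mathbf k})_{\mathbf n,\mathbf k\in\mathbb Z^r}$ is lower-triangular if $f_{\mathbf n\mathbf k}=0$ unless $\mathbf n\ge\mathbf k$. Lower-triangular matrices $f,g$ are mutually inverse if $\sum_{\mathbf l\le\mathbf k\le\mathbf n}f_{\mathbf n\mathbf k}g_{\mathbf k\mathbf l}=\delta_{\mathbf n\mathbf l}$ for all $\mathbf n,\mathbf l$ (equivalently $\sum_{\mathbf l\le\mathbf k\le\mathbf n}g_{\mathbf n\mathbf k}f_{\mathbf k\mathbf l}=\delta_{\mathbf n\mathbf l}$). Empty products are $1$. Parameters are assumed generic so that no denominator vanishes. *)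

theory Defs
  imports "HOL-Analysis.Infinite_Products" "HOL-Library.FuncSet"
begin

definition theta :: "complex \<Rightarrow> complex \<Rightarrow> complex" where
  "theta p x = (\<Prod>j. (1 - p ^ j * x) * (1 - p ^ (j + 1) / x))"

text \<open>
  Elements of \<open>\<int>\<^sup>r\<close> are functions on \<open>{1..r}\<close>, made extensional so that equality of functions is
  equality of multi-indices and the pointwise order \<open>\<le>\<close> on functions is the componentwise order.
\<close>

definition multi_indices :: "nat \<Rightarrow> (nat \<Rightarrow> int) set" where
  "multi_indices r = {1..r} \<rightarrow>\<^sub>E UNIV"

definition weight :: "nat \<Rightarrow> (nat \<Rightarrow> int) \<Rightarrow> int" where
  "weight r k = (\<Sum>i=1..r. k i)"

type_synonym multi_matrix = "(nat \<Rightarrow> int) \<Rightarrow> (nat \<Rightarrow> int) \<Rightarrow> complex"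

definition lower_triangular :: "nat \<Rightarrow> multi_matrix \<Rightarrow> bool" where
  "lower_triangular r f \<longleftrightarrow>
     (\<forall>n\<in>multi_indices r. \<forall>k\<in>multi_indices r. \<not> k \<le> n \<longrightarrow> f n k = 0)"

definition mutually_inverse :: "nat \<Rightarrow> multi_matrix \<Rightarrow> multi_matrix \<Rightarrow> bool" where
  "mutually_inverse r f g \<longleftrightarrow>
     lower_triangular r f \<and> lower_triangular r g \<and>
     (\<forall>n\<in>multi_indices r. \<forall>l\<in>multi_indices r.
        (\<Sum>k | k \<in> multi_indices r \<and> l \<le> k \<and> k \<le> n. f n k * g k l) = (if n = l then 1 else 0) \<and>
        (\<Sum>k | k \<in> multi_indices r \<and> l \<le> k \<and> k \<le> n. g n k * f k l) = (if n = l then 1 else 0))"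

definition cprod :: "nat \<Rightarrow> (nat \<Rightarrow> int \<Rightarrow> complex) \<Rightarrow> (nat \<Rightarrow> int) \<Rightarrow> complex" where
  "cprod r c k = (\<Prod>i=1..r. c i (k i))"

text \<open>
  The expression in braces common to all products over \<open>t\<close> in both matrices, with \<open>x = a(t)\<close> in the
  numerators and \<open>x = c\<^sub>i(t)\<close> in the denominators.
\<close>

definition theta_block ::
  "complex \<Rightarrow> nat \<Rightarrow> (nat \<Rightarrow> int \<Rightarrow> complex) \<Rightarrow> (nat \<Rightarrow> int) \<Rightarrow> complex \<Rightarrow> complex" where
  "theta_block p r c k x = theta p (x * cprod r c k) * (\<Prod>j=1..r. theta p (x / c j (k j)))"

definition f_denom ::
  "complex \<Rightarrow> nat \<Rightarrow> (nat \<Rightarrow> int \<Rightarrow> complex) \<Rightarrow> multi_matrix" where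
  "f_denom p r c n k = (\<Prod>i=1..r. \<Prod>t=k i + 1..n i. theta_block p r c k (c i t))"

definition g_denom ::
  "complex \<Rightarrow> nat \<Rightarrow> (nat \<Rightarrow> int \<Rightarrow> complex) \<Rightarrow> multi_matrix" where
  "g_denom p r c k l = (\<Prod>i=1..r. \<Prod>t=l i..k i - 1. theta_block p r c k (c i t))"

definition f_matrix ::
  "complex \<Rightarrow> nat \<Rightarrow> (int \<Rightarrow> complex) \<Rightarrow> (nat \<Rightarrow> int \<Rightarrow> complex) \<Rightarrow> multi_matrix" where
  "f_matrix p r a c n k =
     (if k \<le> n
      then (\<Prod>t=weight r k..weight r n - 1. theta_block p r c k (a t)) / f_denom p r c n k
      else 0)"

definition g_matrix ::
  "complex \<Rightarrow> nat \<Rightarrow> (int \<Rightarrow> complex) \<Rightarrow> (nat \<Rightarrow> int \<Rightarrow> complex) \<Rightarrow> multi_matrix" where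
  "g_matrix p r a c k l =
     (if l \<le> k
      then theta p (a (weight r l) * cprod r c l) / theta p (a (weight r k) * cprod r c k)
         * (\<Prod>i=1..r. \<Prod>j=i+1..r. theta p (c i (l i) / c j (l j)) / theta p (c i (k i) / c j (k j)))
         * (\<Prod>j=1..r. (c j (l j) ^ j * theta p (a (weight r l) / c j (l j)))
                    / (c j (k j) ^ j * theta p (a (weight r k) / c j (k j))))
         * ((\<Prod>t=weight r l + 1..weight r k. theta_block p r c k (a t)) / g_denom p r c k l)
      else 0)"

text \<open>
  No denominator in any entry \<open>f\<^sub>n\<^sub>k\<close> (\<open>n \<ge> k\<close>) or \<open>g\<^sub>k\<^sub>l\<close> (\<open>k \<ge> l\<close>) vanishes. The factors
  \<open>c\<^sub>j(k\<^sub>j)\<^sup>j\<close> are not listed: they are nonzero because the \<open>c\<^sub>j(k)\<close> are.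
\<close>

definition generic ::
  "complex \<Rightarrow> nat \<Rightarrow> (int \<Rightarrow> complex) \<Rightarrow> (nat \<Rightarrow> int \<Rightarrow> complex) \<Rightarrow> bool" where
  "generic p r a c \<longleftrightarrow>
     (\<forall>n\<in>multi_indices r. \<forall>k\<in>multi_indices r. k \<le> n \<longrightarrow> f_denom p r c n k \<noteq> 0) \<and>
     (\<forall>k\<in>multi_indices r. \<forall>l\<in>multi_indices r. l \<le> k \<longrightarrow> g_denom p r c k l \<noteq> 0) \<and>
     (\<forall>k\<in>multi_indices r.
        theta p (a (weight r k) * cprod r c k) \<noteq> 0 \<and>
        (\<forall>i\<in>{1..r}. \<forall>j\<in>{i+1..r}. theta p (c i (k i) / c j (k j)) \<noteq> 0) \<and>
        (\<forall>j\<in>{1..r}. theta p (a (weight r k) / c j (k j)) \<noteq> 0))"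

end

theory Submission
  imports Defs
begin

text \<open>
  For \<open>n \<noteq> l\<close>, the products in \<open>f\<^sub>n\<^sub>k g\<^sub>k\<^sub>l\<close> combine so that \<open>\<Sum>\<^sub>k f\<^sub>n\<^sub>k g\<^sub>k\<^sub>l = 0\<close> becomes a vanishing
  theorem of Euler--Jacobi type: with \<open>\<Theta>\<^sub>k(x) = \<theta>(x c\<^sub>1(k\<^sub>1)\<cdots>c\<^sub>r(k\<^sub>r)) \<Prod>\<^sub>j \<theta>(x/c\<^sub>j(k\<^sub>j))\<close> and \<open>N\<close> the number of
  factors in \<open>\<Prod>\<^sub>i \<Prod>\<^bsub>t\<noteq>k\<^sub>i\<^esub>\<close>, the sum over a box of
  \<open>\<Prod>\<^bsub>1\<le>m<N\<^esub> \<Theta>\<^sub>k(x\<^sub>m) / (V(k) \<Prod>\<^sub>i \<Prod>\<^bsub>t\<noteq>k\<^sub>i\<^esub> \<Theta>\<^sub>k(c\<^sub>i(t)))\<close> is zero, where \<open>V\<close> is the theta Vandermonde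
  product. The functions \<open>\<Theta>\<^sub>k\<close> all lie in the same \<open>(r+1)\<close>-dimensional space of theta functions, so
  \<open>\<Theta>\<^sub>k(x\<^sub>1)\<close> is a combination of its values at \<open>r+1\<close> nodes \<open>c\<^sub>i(s)\<close>, with coefficients independent of
  \<open>k\<close>. Each such value cancels a factor of the denominator, and induction reduces \<open>N\<close> to \<open>1\<close>, where
  two terms cancel by antisymmetry.

  The interpolation formula follows by induction from Weierstrass' addition formula. The latter is the
  vanishing of a \<open>3 \<times> 3\<close> determinant: by the Jacobi triple product, \<open>\<theta>(x/b) \<theta>(xb/s)\<close> is a kernel of
  rank two in \<open>(x, b)\<close>. This argument also covers \<open>p = 0\<close>.
\<close>

section \<open>The Jacobi triple product\<close>

text \<open>Tannery's theorem, used to let the number of factors tend to infinity in the finite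
  triple product. By the Weierstrass M-test the partial sums converge uniformly in \<open>n\<close>,
  so the two limits may be interchanged.\<close>

lemma tannery_infsum:
  fixes f :: "'a \<Rightarrow> nat \<Rightarrow> 'b::banach"
  assumes "\<And>k. f k \<longlonglongrightarrow> b k" and bound: "\<And>k n. norm (f k n) \<le> M k" and "M summable_on UNIV"
  shows "(\<lambda>n. \<Sum>\<^sub>\<infinity>k. f k n) \<longlonglongrightarrow> (\<Sum>\<^sub>\<infinity>k. b k)"
proof (rule swap_uniform_limit')
  show "uniform_limit UNIV (\<lambda>X n. \<Sum>k\<in>X. f k n) (\<lambda>n. \<Sum>\<^sub>\<infinity>k. f k n) (finite_subsets_at_top UNIV)"
    using bound \<open>M summable_on UNIV\<close> by (intro Weierstrass_m_test_general) auto
  show "\<forall>\<^sub>F X in finite_subsets_at_top UNIV. ((\<lambda>n. \<Sum>k\<in>X. f k n) \<longlonglongrightarrow> (\<Sum>k\<in>X. b k))"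
    by (intro always_eventually allI tendsto_sum assms)
  have "norm (b k) \<le> M k" for k
    by (rule LIMSEQ_le_const2[OF tendsto_norm[OF assms(1)]]) (use bound in auto)
  then have "b abs_summable_on UNIV"
    by (intro abs_summable_on_comparison_test'[OF \<open>M summable_on UNIV\<close>])
  then have "b summable_on UNIV"
    by (rule abs_summable_summable)
  then show "((\<lambda>X. \<Sum>k\<in>X. b k) \<longlongrightarrow> (\<Sum>\<^sub>\<infinity>k. b k)) (finite_subsets_at_top UNIV)"
    using has_sum_def has_sum_infsum by blast
qed auto

section \<open>Convergence of the theta series\<close>

definition tri :: "int \<Rightarrow> nat" where
  "tri k = nat (k * (k - 1) div 2)"

lemma two_tri: "2 * int (tri k) = k * (k - 1)"
proof -
  have "k * (k - 1) \<ge> 0"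
    by (cases "k \<ge> 1") (auto simp: mult_nonneg_nonneg mult_nonpos_nonpos)
  moreover have "even (k * (k - 1))" by simp
  ultimately show ?thesis unfolding tri_def by (simp add: algebra_simps)
qed

lemma tri_reflect: "tri (1 - k) = tri k"
  using two_tri[of k] two_tri[of "1 - k"] by (simp add: algebra_simps)

lemma tri_Suc: "tri (int (Suc n)) = tri (int n) + n"
  using two_tri[of "int n"] two_tri[of "int (Suc n)"] by (simp add: algebra_simps)

text \<open>Successive terms have ratio \<open>q ^ n * y\<close>, which tends to 0, so the ratio
  test applies however large \<open>y\<close> is.\<close>

lemma summable_theta_bound_nat:
  fixes q y :: real
  assumes "0 \<le> q" "q < 1" "y > 0"
  shows "summable (\<lambda>n. q ^ tri (int n) * y ^ n)"
proof -
  have "(\<lambda>n. q ^ n * y) \<longlonglongrightarrow> 0 * y"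
    by (intro tendsto_intros) (use assms in auto)
  then have "\<forall>\<^sub>F n in sequentially. q ^ n * y < 1 / 2"
    by (rule order_tendstoD) auto
  then obtain N where N: "q ^ n * y < 1 / 2" if "n \<ge> N" for n
    unfolding eventually_sequentially by blast
  show ?thesis
  proof (rule summable_ratio_test[of "1/2" N])
    fix n assume "n \<ge> N"
    have "norm (q ^ tri (int (Suc n)) * y ^ Suc n) = (q ^ tri (int n) * y ^ n) * (q ^ n * y)"
      using assms unfolding tri_Suc by (simp add: power_add)
    also have "\<dots> \<le> (q ^ tri (int n) * y ^ n) * (1 / 2)"
      by (rule mult_left_mono) (use N[OF \<open>n \<ge> N\<close>] assms in auto)
    finally show "norm (q ^ tri (int (Suc n)) * y ^ Suc n) \<le> 1 / 2 * norm (q ^ tri (int n) * y ^ n)"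
      using assms by simp
  qed simp
qed

lemma summable_theta_bound:
  fixes q y :: real
  assumes "0 \<le> q" "q < 1" "y > 0"
  shows "(\<lambda>k. q ^ tri k * y powi k) summable_on UNIV"
proof -
  have "(\<lambda>n. q ^ tri (int n) * y ^ n) summable_on UNIV"
    by (intro norm_summable_imp_summable_on) (use summable_theta_bound_nat[OF assms] assms in simp)
  also have "?this \<longleftrightarrow> (\<lambda>k. q ^ tri k * y powi k) summable_on {0..}"
    by (rule summable_on_reindex_bij_witness[of _ nat int]) auto
  finally have pos: "(\<lambda>k. q ^ tri k * y powi k) summable_on {0..}" .
  \<comment> \<open>The negative indices: since \<open>tri (- int n) = tri (int (Suc n))\<close>,
    the term at \<open>- int n\<close> is \<open>y\<close> times the term at \<open>Suc n\<close> of
    the same series with \<open>1 / y\<close> in place of \<open>y\<close>.\<close>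
  have "summable (\<lambda>n. y * (q ^ tri (int (Suc n)) * (1 / y) ^ Suc n))"
    using summable_theta_bound_nat[of q "1 / y"] assms
    by (intro summable_mult) (subst summable_Suc_iff, auto)
  then have "(\<lambda>n. y * (q ^ tri (int (Suc n)) * (1 / y) ^ Suc n)) summable_on UNIV"
    using assms by (intro norm_summable_imp_summable_on) simp
  then have "(\<lambda>n. y * (q ^ tri (int (Suc n)) * (1 / y) ^ Suc n)) summable_on {1..}"
    by (rule summable_on_subset_banach) simp
  also have "?this \<longleftrightarrow> (\<lambda>k. q ^ tri k * y powi k) summable_on {..<0}"
  proof (rule summable_on_reindex_bij_witness[of _ "\<lambda>k. nat (- k)" "\<lambda>n. - int n"])
    fix n :: nat assume "n \<in> {1..}"
    have "tri (- int n) = tri (int (Suc n))"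
      using tri_reflect[of "int (Suc n)"] by simp
    then show "q ^ tri (- int n) * y powi (- int n) = y * (q ^ tri (int (Suc n)) * (1 / y) ^ Suc n)"
      using assms by (simp add: power_int_minus field_simps)
  qed auto
  finally have "(\<lambda>k. q ^ tri k * y powi k) summable_on ({0..} \<union> {..<0})"
    by (intro summable_on_Un_disjoint pos) auto
  also have "{0..} \<union> {..<0} = (UNIV :: int set)" by auto
  finally show ?thesis .
qed

text \<open>Up to a constant factor, the Laurent coefficients of theta. As \<open>tri k\<close> is a
  natural number, the case \<open>p = 0\<close> is included: there only \<open>k = 0\<close> and
  \<open>k = 1\<close> survive.\<close>

definition theta_coeff :: "complex \<Rightarrow> int \<Rightarrow> complex" where
  "theta_coeff p k = (- 1) powi k * p ^ tri k"

lemma norm_theta_term: "norm (theta_coeff p k * x powi k) = norm p ^ tri k * norm x powi k"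
  by (simp add: theta_coeff_def norm_mult norm_power norm_power_int)

lemma theta_coeff_abs_summable:
  assumes "norm p < 1" "x \<noteq> 0"
  shows "(\<lambda>k. norm (theta_coeff p k * x powi k)) summable_on UNIV"
  unfolding norm_theta_term by (rule summable_theta_bound) (use assms in auto)

section \<open>Finite form of the triple product and its limit\<close>

definition euler_prod :: "complex \<Rightarrow> nat \<Rightarrow> complex" where
  "euler_prod p n = (\<Prod>i<n. 1 - p ^ Suc i)"

text \<open>The value 0 at negative arguments is the usual convention for reciprocal q-factorials;
  it turns the finite expansion below into a sum over all integers.\<close>

definition inv_euler :: "complex \<Rightarrow> int \<Rightarrow> complex" where
  "inv_euler p m = (if m < 0 then 0 else 1 / euler_prod p (nat m))"

lemma one_minus_power_nonzero:
  assumes "norm (p::complex) < 1"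
  shows "1 - p ^ Suc n \<noteq> 0"
proof
  assume "1 - p ^ Suc n = 0"
  then have "norm p ^ Suc n = 1" by (metis eq_iff_diff_eq_0 norm_one norm_power)
  then show False
    using assms power_Suc_less_one[of "norm p" n] by (cases "norm p = 0") auto
qed

lemma euler_prod_nonzero:
  assumes "norm p < 1"
  shows "euler_prod p n \<noteq> 0"
  unfolding euler_prod_def using one_minus_power_nonzero[OF assms] by auto

text \<open>This persists across the boundary: at \<open>m = -1\<close> the factor
  \<open>1 - p ^ 0\<close> is 0, and below that both values of \<open>inv_euler\<close> are
  0.\<close>

lemma inv_euler_rec:
  assumes "norm p < 1"
  shows "inv_euler p m = (1 - p ^ nat (m + 1)) * inv_euler p (m + 1)"
proof (cases "m < 0")
  case True
  then show ?thesis by (cases "m = -1") (auto simp: inv_euler_def)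
next
  case False
  then have *: "nat (m + 1) = Suc (nat m)" by simp
  show ?thesis
    using False one_minus_power_nonzero[OF assms, of "nat m"] euler_prod_nonzero[OF assms, of "nat m"]
    unfolding inv_euler_def * by (simp add: euler_prod_def del: power_Suc)
qed

lemma euler_prod_limit:
  assumes "norm p < 1"
  obtains e where "euler_prod p \<longlonglongrightarrow> e" "e \<noteq> 0"
proof -
  have "summable (\<lambda>i. norm p * norm p ^ i)"
    using assms by (intro summable_mult summable_geometric) auto
  then have "abs_convergent_prod (\<lambda>i. 1 - p ^ Suc i)"
    unfolding abs_convergent_prod_conv_summable by (simp add: norm_power norm_mult)
  then have conv: "convergent_prod (\<lambda>i. 1 - p ^ Suc i)"
    by (rule abs_convergent_prod_imp_convergent_prod)
  have "(\<lambda>n. \<Prod>i<n. 1 - p ^ Suc i) \<longlonglongrightarrow> prodinf (\<lambda>i. 1 - p ^ Suc i)"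
    using convergent_prod_LIMSEQ[OF conv] LIMSEQ_lessThan_iff_atMost[of "\<lambda>A. \<Prod>i\<in>A. 1 - p ^ Suc i"] by simp
  moreover have "prodinf (\<lambda>i. 1 - p ^ Suc i) \<noteq> 0"
    using conv one_minus_power_nonzero[OF assms] by (intro prodinf_nonzero) auto
  ultimately show ?thesis
    using that unfolding euler_prod_def by blast
qed

definition theta_partial :: "complex \<Rightarrow> nat \<Rightarrow> complex \<Rightarrow> complex" where
  "theta_partial p n x = (\<Prod>j<n. (1 - p ^ j * x) * (1 - p ^ (j + 1) / x))"

lemma theta_convergent:
  fixes p x :: complex
  assumes "norm p < 1"
  shows "convergent_prod (\<lambda>j. (1 - p ^ j * x) * (1 - p ^ (j + 1) / x))"
proof -
  have *: "summable (\<lambda>i. norm y * norm p ^ i)" for y :: complex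
    using assms by (intro summable_mult summable_geometric) auto
  have "abs_convergent_prod (\<lambda>j. 1 - p ^ j * x)"
    unfolding abs_convergent_prod_conv_summable using *[of x] by (simp add: norm_power norm_mult mult_ac)
  then have 1: "convergent_prod (\<lambda>j. 1 - p ^ j * x)"
    by (rule abs_convergent_prod_imp_convergent_prod)
  have "abs_convergent_prod (\<lambda>j. 1 - p ^ (j + 1) / x)"
    unfolding abs_convergent_prod_conv_summable using *[of "p / x"]
    by (simp add: norm_power norm_mult norm_divide mult_ac)
  then have 2: "convergent_prod (\<lambda>j. 1 - p ^ (j + 1) / x)"
    by (rule abs_convergent_prod_imp_convergent_prod)
  show ?thesis
    using convergent_prod_mult[OF 1 2] by simp
qed

lemma theta_partial_tendsto:
  assumes "norm p < 1"
  shows "(\<lambda>n. theta_partial p n x) \<longlonglongrightarrow> theta p x"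
  using convergent_prod_LIMSEQ[OF theta_convergent[OF assms, of x]]
    LIMSEQ_lessThan_iff_atMost[of "\<lambda>A. \<Prod>j\<in>A. (1 - p ^ j * x) * (1 - p ^ (j + 1) / x)"]
  by (simp add: theta_partial_def theta_def)

text \<open>The factor in parentheses is the Gaussian binomial coefficient "2n choose n + k" in base
  \<open>p\<close>, so these are the coefficients of the finite Jacobi triple product.\<close>

definition partial_coeff :: "complex \<Rightarrow> nat \<Rightarrow> int \<Rightarrow> complex" where
  "partial_coeff p n k =
     theta_coeff p k * (euler_prod p (2 * n) * inv_euler p (int n - k) * inv_euler p (int n + k))"

lemma partial_coeff_outside: "\<bar>k\<bar> > int n \<Longrightarrow> partial_coeff p n k = 0"
  by (auto simp: partial_coeff_def inv_euler_def)

text \<open>Comparison of coefficients when \<open>theta_partial p n x\<close> is multiplied by its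
  next factor, \<open>(1 - p ^ n * x) * (1 - p ^ (n + 1) / x) = 1 + p ^ (2 * n + 1) - p ^ n * x - p
  ^ (n + 1) / x\<close>.\<close>

lemma partial_coeff_rec:
  assumes "norm p < 1"
  shows "partial_coeff p (Suc n) k = (1 + p ^ (2 * n + 1)) * partial_coeff p n k
    - p ^ n * partial_coeff p n (k - 1) - p ^ (n + 1) * partial_coeff p n (k + 1)"
proof (cases "\<bar>k\<bar> > int n + 1")
  case True
  then show ?thesis by (simp add: partial_coeff_outside)
next
  case False
  \<comment> \<open>\<open>A\<close> and \<open>B\<close> are the arguments of
    \<open>inv_euler\<close> at level \<open>Suc n\<close>. Writing the values at level
    \<open>n\<close> through them makes \<open>s * t * X\<close> a common factor of all four
    terms.\<close>
  define A where "A = nat (int n - k + 1)"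
  define B where "B = nat (int n + k + 1)"
  have AB: "int A = int n - k + 1" "int B = int n + k + 1"
    using False by (auto simp: A_def B_def)
  have sum: "A + B = 2 * n + 2" using AB by linarith
  define a b m where "a = p ^ A" and "b = p ^ B" and "m = p ^ (2 * n + 1)"
  have ab: "a * b = p * m"
    using sum by (simp add: a_def b_def m_def flip: power_add power_Suc)
  define X where "X = euler_prod p (2 * n) * inv_euler p (int A) * inv_euler p (int B)"
  define s where "s = (-1::complex) powi k"
  define t where "t = p ^ tri k"
  have rA: "inv_euler p (int n - k) = (1 - a) * inv_euler p (int A)"
    using inv_euler_rec[OF assms, of "int n - k"] by (simp only: AB(1)[symmetric] a_def nat_int)
  have rB: "inv_euler p (int n + k) = (1 - b) * inv_euler p (int B)"
    using inv_euler_rec[OF assms, of "int n + k"] by (simp only: AB(2)[symmetric] b_def nat_int)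
  have c0: "partial_coeff p n k = s * t * (1 - a) * (1 - b) * X"
    unfolding partial_coeff_def rA rB by (simp add: X_def theta_coeff_def s_def t_def)
  have eu: "euler_prod p (2 * Suc n) = euler_prod p (2 * n) * (1 - m) * (1 - a * b)"
    by (simp add: euler_prod_def m_def ab)
  have e: "int (Suc n) - k = int A" "int (Suc n) + k = int B" using AB by auto
  have c1: "partial_coeff p (Suc n) k = s * t * (1 - m) * (1 - a * b) * X"
    unfolding partial_coeff_def eu e by (simp add: X_def theta_coeff_def s_def t_def)
  have cm: "p ^ n * partial_coeff p n (k - 1) = - s * t * (a - m) * (1 - b) * X"
  \<comment> \<open>At the edge \<open>k = - int n - 1\<close> both sides are 0, the right one
    because of \<open>1 - b\<close>. Otherwise \<open>B - 1\<close> is available as an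
    exponent.\<close>
  proof (cases "B = 0")
    case True
    then show ?thesis
      using AB by (simp add: partial_coeff_def inv_euler_def b_def)
  next
    case False
    then obtain B' where B': "B = Suc B'" by (cases B) auto
    have i: "int n + (k - 1) + 1 = int n + k" "nat (int n + k) = B'"
      using AB B' by linarith+
    have "inv_euler p (int n + (k - 1)) = (1 - p ^ B') * ((1 - b) * inv_euler p (int B))"
      using inv_euler_rec[OF assms, of "int n + (k - 1)"] unfolding i rB .
    moreover have "int n - (k - 1) = int A" using AB by simp
    moreover have "(-1) powi (k - 1) = - s"
      by (simp add: s_def power_int_diff)
    moreover have "p ^ n * p ^ tri (k - 1) = t * a"
    proof -
      have "int (n + tri (k - 1)) = int (tri k + A)"
        using two_tri[of k] two_tri[of "k - 1"] AB by (simp add: algebra_simps)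
      then have "n + tri (k - 1) = tri k + A" by linarith
      then show ?thesis by (simp add: t_def a_def flip: power_add)
    qed
    moreover have "a * p ^ B' = m"
      using sum B' by (simp add: a_def m_def flip: power_add)
    ultimately have "p ^ n * partial_coeff p n (k - 1) = - s * (t * a) * (1 - b) * (1 - p ^ B') * X"
      by (simp add: partial_coeff_def theta_coeff_def X_def mult_ac)
    also have "\<dots> = - s * t * (a - a * p ^ B') * (1 - b) * X"
      by (simp add: algebra_simps)
    finally show ?thesis using \<open>a * p ^ B' = m\<close> by simp
  qed
  have cp: "p ^ (n + 1) * partial_coeff p n (k + 1) = - s * t * (b - m) * (1 - a) * X"
  proof (cases "A = 0")
    case True
    then show ?thesis
      using AB by (simp add: partial_coeff_def inv_euler_def a_def)
  next
    case False
    then obtain A' where A': "A = Suc A'" by (cases A) auto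
    have i: "int n - (k + 1) + 1 = int n - k" "nat (int n - k) = A'"
      using AB A' by linarith+
    have "inv_euler p (int n - (k + 1)) = (1 - p ^ A') * ((1 - a) * inv_euler p (int A))"
      using inv_euler_rec[OF assms, of "int n - (k + 1)"] unfolding i rA .
    moreover have "int n + (k + 1) = int B" using AB by simp
    moreover have "(-1) powi (k + 1) = - s"
      by (simp add: s_def power_int_add)
    moreover have "p ^ (n + 1) * p ^ tri (k + 1) = t * b"
    proof -
      have "int (n + 1 + tri (k + 1)) = int (tri k + B)"
        using two_tri[of k] two_tri[of "k + 1"] AB by (simp add: algebra_simps)
      then have "n + 1 + tri (k + 1) = tri k + B" by linarith
      then show ?thesis unfolding t_def b_def by (simp only: power_add[symmetric])
    qed
    moreover have "b * p ^ A' = m"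
    proof -
      have "B + A' = 2 * n + 1" using sum A' by simp
      then show ?thesis unfolding b_def m_def by (simp only: power_add[symmetric])
    qed
    ultimately have "p ^ (n + 1) * partial_coeff p n (k + 1) = - s * (t * b) * (1 - a) * (1 - p ^ A') * X"
      by (simp add: partial_coeff_def theta_coeff_def X_def mult_ac)
    also have "\<dots> = - s * t * (b - b * p ^ A') * (1 - a) * X"
      by (simp add: algebra_simps)
    finally show ?thesis using \<open>b * p ^ A' = m\<close> by simp
  qed
  \<comment> \<open>Apart from the common factor this is \<open>(1 - m) * (1 - a * b) = (1 + m) * (1
    - a) * (1 - b) + (a - m) * (1 - b) + (b - m) * (1 - a)\<close>.\<close>
  show ?thesis
    unfolding c0 c1 cm cp m_def[symmetric] by algebra
qed

lemma theta_partial_has_sum: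
  assumes "norm p < 1" "x \<noteq> 0"
  shows "((\<lambda>k. partial_coeff p n k * x powi k) has_sum theta_partial p n x) UNIV"
proof (induction n)
  case 0
  show ?case
    by (rule has_sum_finite_neutralI[of "{0}"])
       (auto simp: partial_coeff_outside partial_coeff_def theta_partial_def theta_coeff_def tri_def
          inv_euler_def euler_prod_def)
next
  case (Suc n)
  have shift: "((\<lambda>k. partial_coeff p n (k + d) * x powi (k + d)) has_sum theta_partial p n x) UNIV" for d
    using Suc by (subst has_sum_reindex_bij_witness[of _ "\<lambda>k. k - d" "\<lambda>k. k + d" UNIV
        "\<lambda>k. partial_coeff p n k * x powi k" _ _ "theta_partial p n x"]) auto
  have "((\<lambda>k. (1 + p ^ (2 * n + 1)) * (partial_coeff p n k * x powi k)
      + (- (p ^ n * x) * (partial_coeff p n (k + -1) * x powi (k + -1))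
      + - (p ^ (n + 1) / x) * (partial_coeff p n (k + 1) * x powi (k + 1))))
     has_sum ((1 + p ^ (2 * n + 1)) * theta_partial p n x
       + (- (p ^ n * x) * theta_partial p n x + - (p ^ (n + 1) / x) * theta_partial p n x))) UNIV"
    by (intro has_sum_add has_sum_cmult_right Suc shift)
  also have "(\<lambda>k. (1 + p ^ (2 * n + 1)) * (partial_coeff p n k * x powi k)
      + (- (p ^ n * x) * (partial_coeff p n (k + -1) * x powi (k + -1))
      + - (p ^ (n + 1) / x) * (partial_coeff p n (k + 1) * x powi (k + 1))))
     = (\<lambda>k. partial_coeff p (Suc n) k * x powi k)"
  proof
    fix k
    have "x * x powi (k + -1) = x powi k" "x powi (k + 1) = x * x powi k"
      using assms by (simp_all add: power_int_diff power_int_add)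
    then have xs: "p ^ n * x * (partial_coeff p n (k + -1) * x powi (k + -1)) = p ^ n * partial_coeff p n (k - 1) * x powi k"
      "p ^ (n + 1) / x * (partial_coeff p n (k + 1) * x powi (k + 1)) = p ^ (n + 1) * partial_coeff p n (k + 1) * x powi k"
      using assms by (simp_all add: mult_ac)
    show "(1 + p ^ (2 * n + 1)) * (partial_coeff p n k * x powi k)
      + (- (p ^ n * x) * (partial_coeff p n (k + -1) * x powi (k + -1))
      + - (p ^ (n + 1) / x) * (partial_coeff p n (k + 1) * x powi (k + 1)))
      = partial_coeff p (Suc n) k * x powi k"
      unfolding partial_coeff_rec[OF assms(1)]
      by (simp only: minus_mult_left[symmetric] xs) (simp add: algebra_simps)
  qed
  also have "(1 + p ^ (2 * n + 1)) * theta_partial p n x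
       + (- (p ^ n * x) * theta_partial p n x + - (p ^ (n + 1) / x) * theta_partial p n x)
     = theta_partial p (Suc n) x"
    using assms by (simp add: theta_partial_def field_simps) (simp add: power_add power_mult power2_eq_square algebra_simps)
  finally show ?case .
qed

text \<open>\<open>K\<close> is the reciprocal of the limit of \<open>euler_prod p\<close>: every
  Gaussian binomial in \<open>partial_coeff p n k\<close> tends to it as \<open>n\<close> grows, and
  Tannery's theorem moves the limit inside the sum. What matters later is that \<open>K\<close> is
  the same for all \<open>x\<close>.\<close>

proposition jacobi_triple_product:
  assumes p: "norm p < 1"
  obtains K where "\<And>x. x \<noteq> 0 \<Longrightarrow> ((\<lambda>k. K * (theta_coeff p k * x powi k)) has_sum theta p x) UNIV"
proof -
  obtain e where e: "euler_prod p \<longlonglongrightarrow> e" "e \<noteq> 0"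
    using euler_prod_limit[OF p] by blast
  have "Bseq (euler_prod p)"
    using e by (intro convergent_imp_Bseq) (auto simp: convergent_def)
  then obtain U where U: "\<And>n. norm (euler_prod p n) \<le> U" "U > 0"
    by (auto simp: Bseq_def)
  \<comment> \<open>As \<open>e\<close> is nonzero, the reciprocals are bounded too;
    \<open>U * V * V\<close> then bounds the Gaussian binomials uniformly in \<open>n\<close> and
    \<open>k\<close>.\<close>
  have "Bseq (\<lambda>n. 1 / euler_prod p n)"
    using e by (intro convergent_imp_Bseq) (auto simp: convergent_def intro!: tendsto_intros)
  then obtain V where V: "\<And>n. norm (1 / euler_prod p n) \<le> V" "V > 0"
    by (auto simp: Bseq_def)
  have V': "norm (inv_euler p m) \<le> V" for m
    using V by (auto simp: inv_euler_def)
  have lim: "(\<lambda>n. inv_euler p (int n + k)) \<longlonglongrightarrow> 1 / e" for k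
  proof -
    have "filterlim (\<lambda>n. nat (int n + k)) at_top sequentially"
      unfolding filterlim_at_top
    proof
      fix Z :: nat
      show "\<forall>\<^sub>F n in sequentially. Z \<le> nat (int n + k)"
        using eventually_ge_at_top[of "Z + nat \<bar>k\<bar>"] by eventually_elim linarith
    qed
    then have "(\<lambda>n. 1 / euler_prod p (nat (int n + k))) \<longlonglongrightarrow> 1 / e"
      using e by (intro tendsto_intros filterlim_compose[OF e(1)])
    moreover have "\<forall>\<^sub>F n in sequentially. 1 / euler_prod p (nat (int n + k)) = inv_euler p (int n + k)"
      using eventually_ge_at_top[of "nat \<bar>k\<bar>"] by eventually_elim (auto simp: inv_euler_def)
    ultimately show ?thesis by (rule Lim_transform_eventually)
  qed
  have "((\<lambda>k. 1 / e * (theta_coeff p k * x powi k)) has_sum theta p x) UNIV" if x: "x \<noteq> 0" for x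
  proof -
    have "(\<lambda>n. \<Sum>\<^sub>\<infinity>k. partial_coeff p n k * x powi k) \<longlonglongrightarrow> (\<Sum>\<^sub>\<infinity>k. 1 / e * (theta_coeff p k * x powi k))"
    proof (rule tannery_infsum)
      fix k
      have "(\<lambda>n. euler_prod p (2 * n)) \<longlonglongrightarrow> e"
        by (rule filterlim_compose[OF e(1)]) (simp add: filterlim_subseq strict_mono_def)
      then have "(\<lambda>n. theta_coeff p k * (euler_prod p (2 * n) * inv_euler p (int n + - k) * inv_euler p (int n + k)) * x powi k)
         \<longlonglongrightarrow> theta_coeff p k * (e * (1 / e) * (1 / e)) * x powi k"
        by (intro tendsto_intros lim)
      then show "(\<lambda>n. partial_coeff p n k * x powi k) \<longlonglongrightarrow> 1 / e * (theta_coeff p k * x powi k)"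
        using e(2) by (simp add: partial_coeff_def)
      fix n
      have "norm (partial_coeff p n k * x powi k)
         = norm (euler_prod p (2 * n)) * norm (inv_euler p (int n - k)) * norm (inv_euler p (int n + k))
           * norm (theta_coeff p k * x powi k)"
        by (simp add: partial_coeff_def norm_mult)
      also have "\<dots> \<le> U * V * V * norm (theta_coeff p k * x powi k)"
        by (intro mult_mono U V') (use U V in auto)
      finally show "norm (partial_coeff p n k * x powi k) \<le> U * V * V * norm (theta_coeff p k * x powi k)" .
    next
      show "(\<lambda>k. U * V * V * norm (theta_coeff p k * x powi k)) summable_on UNIV"
        by (intro summable_on_cmult_right theta_coeff_abs_summable p x)
    qed
    moreover have "(\<Sum>\<^sub>\<infinity>k. partial_coeff p n k * x powi k) = theta_partial p n x" for n
      using theta_partial_has_sum[OF p x] by (rule infsumI)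
    ultimately have "theta p x = (\<Sum>\<^sub>\<infinity>k. 1 / e * (theta_coeff p k * x powi k))"
      using LIMSEQ_unique theta_partial_tendsto[OF p, of x] by simp
    moreover have "(\<lambda>k. 1 / e * (theta_coeff p k * x powi k)) summable_on UNIV"
      using abs_summable_summable[OF theta_coeff_abs_summable[OF p x]] by (rule summable_on_cmult_right)
    ultimately show ?thesis
      by (simp only: has_sum_infsum)
  qed
  then show ?thesis by (rule that)
qed

section \<open>Addition formula and interpolation\<close>

lemma has_sum_product:
  fixes f :: "'a \<Rightarrow> complex" and g :: "'b \<Rightarrow> complex"
  assumes "(f has_sum S) A" "(g has_sum T) B"
  shows "((\<lambda>(m, n). f m * g n) has_sum S * T) (A \<times> B)"
proof (rule has_sum_SigmaI)
  have f: "f abs_summable_on A" and g: "g abs_summable_on B"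
    using assms summable_on_iff_abs_summable_on_complex has_sum_imp_summable by blast+
  have "(\<lambda>(m, n). norm (f m) * norm (g n)) summable_on A \<times> B"
  proof (rule summable_on_SigmaI)
    show "((\<lambda>n. case (m, n) of (m, n) \<Rightarrow> norm (f m) * norm (g n))
        has_sum norm (f m) * (\<Sum>\<^sub>\<infinity>n\<in>B. norm (g n))) B" for m
      using g by (simp add: has_sum_cmult_right)
    show "(\<lambda>m. norm (f m) * (\<Sum>\<^sub>\<infinity>n\<in>B. norm (g n))) summable_on A"
      using f by (intro summable_on_cmult_left)
  qed auto
  then have "(\<lambda>(m, n). f m * g n) abs_summable_on A \<times> B"
    by (simp add: case_prod_unfold norm_mult)
  then show "(\<lambda>(m, n). f m * g n) summable_on A \<times> B"
    by (rule abs_summable_summable)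
  show "((\<lambda>n. case (m, n) of (m, n) \<Rightarrow> f m * g n) has_sum f m * T) B" for m
    using assms by (simp add: has_sum_cmult_right)
  show "((\<lambda>m. f m * T) has_sum S * T) A"
    using assms by (intro has_sum_cmult_left)
qed

section \<open>Reflection and zeros of theta\<close>

lemma theta_inverse:
  assumes p: "norm p < 1" and x: "x \<noteq> 0"
  shows "theta p (1 / x) = - theta p x / x"
proof -
  obtain K where K: "\<And>x. x \<noteq> 0 \<Longrightarrow> ((\<lambda>k. K * (theta_coeff p k * x powi k)) has_sum theta p x) UNIV"
    using jacobi_triple_product[OF p] by blast
  have "((\<lambda>k. K * (theta_coeff p k * (1 / x) powi k)) has_sum theta p (1 / x)) UNIV"
    using K[of "1 / x"] x by simp
  \<comment> \<open>Under the reflection of \<open>k\<close> to \<open>1 - k\<close>,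
    \<open>tri\<close> is invariant, the sign changes, and one factor \<open>x\<close> splits
    off.\<close>
  also have "?this \<longleftrightarrow> ((\<lambda>k. (- 1 / x) * (K * (theta_coeff p k * x powi k))) has_sum theta p (1 / x)) UNIV"
  proof (rule has_sum_reindex_bij_witness[of _ "\<lambda>k. 1 - k" "\<lambda>k. 1 - k"])
    fix k :: int
    have "(-1::complex) powi (1 - k) = - ((-1) powi k)"
      by (simp add: power_int_diff power_int_minus_left)
    moreover have "x powi (1 - k) = x * (1 / x) powi k"
      using x by (simp add: power_int_diff power_int_divide_distrib)
    ultimately show "(- 1 / x) * (K * (theta_coeff p (1 - k) * x powi (1 - k)))
        = K * (theta_coeff p k * (1 / x) powi k)"
      using x by (simp add: theta_coeff_def tri_reflect)
  qed auto
  finally have "((\<lambda>k. (- 1 / x) * (K * (theta_coeff p k * x powi k))) has_sum theta p (1 / x)) UNIV" .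
  moreover have "((\<lambda>k. (- 1 / x) * (K * (theta_coeff p k * x powi k))) has_sum (- 1 / x) * theta p x) UNIV"
    by (intro has_sum_cmult_right K x)
  ultimately have "theta p (1 / x) = (- 1 / x) * theta p x"
    using has_sum_unique by blast
  then show ?thesis by simp
qed

lemma theta_one: "norm p < 1 \<Longrightarrow> theta p 1 = 0"
  using theta_inverse[of p 1] by simp

lemma theta_swap:
  assumes "norm p < 1" "x \<noteq> 0" "y \<noteq> 0"
  shows "x * theta p (y / x) = - y * theta p (x / y)"
  using theta_inverse[of p "x / y"] assms by simp

text \<open>The zeros are the integral powers of \<open>p\<close>. Clearing denominators avoids
  negative powers, and \<open>p ^ n \<noteq> 0\<close> keeps the description correct for
  \<open>p = 0\<close>, where 1 is the only zero.\<close>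

lemma theta_eq_0_iff:
  assumes p: "norm p < 1" and y: "y \<noteq> 0"
  shows "theta p y = 0 \<longleftrightarrow> (\<exists>m n. p ^ m * y = p ^ n \<and> p ^ n \<noteq> 0)"
proof
  assume "theta p y = 0"
  then obtain j where "(1 - p ^ j * y) * (1 - p ^ (j + 1) / y) = 0"
    unfolding theta_def using prodinf_nonzero[OF theta_convergent[OF p]] by blast
  then have "p ^ j * y = p ^ 0 \<or> p ^ 0 * y = p ^ (j + 1)"
    using y by (auto simp: right_minus_eq eq_divide_eq_1)
  then show "\<exists>m n. p ^ m * y = p ^ n \<and> p ^ n \<noteq> 0"
    using y by (metis mult_eq_0_iff power_0 zero_neq_one)
next
  assume "\<exists>m n. p ^ m * y = p ^ n \<and> p ^ n \<noteq> 0"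
  then obtain m n where mn: "p ^ m * y = p ^ n" "p ^ n \<noteq> 0" by blast
  have "\<exists>j. (1 - p ^ j * y) * (1 - p ^ (j + 1) / y) = 0"
  proof (cases "m \<ge> n")
    case True
    then have "p ^ n * (p ^ (m - n) * y) = p ^ n * 1"
      using mn by (simp flip: power_add mult.assoc)
    then have "p ^ (m - n) * y = 1" using mn(2) by (metis mult_cancel_left)
    then show ?thesis by (intro exI[of _ "m - n"]) simp
  next
    case False
    then obtain d where d: "n = m + (d + 1)"
      by (metis Suc_eq_plus1 add_Suc_right less_imp_Suc_add not_le)
    then have "p ^ m * y = p ^ m * p ^ (d + 1)"
      using mn by (simp only: power_add)
    then have "y = p ^ (d + 1)" using mn y by auto
    then show ?thesis using y by (intro exI[of _ d]) simp
  qed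
  then obtain j where j: "(1 - p ^ j * y) * (1 - p ^ (j + 1) / y) = 0" by blast
  have "(\<lambda>j. (1 - p ^ j * y) * (1 - p ^ (j + 1) / y)) has_prod theta p y"
    unfolding theta_def by (rule convergent_prod_has_prod[OF theta_convergent[OF p]])
  then have "theta p y = 0 \<longleftrightarrow> 0 \<in> range (\<lambda>j. (1 - p ^ j * y) * (1 - p ^ (j + 1) / y))"
    by (rule has_prod_eq_0_iff)
  moreover have "0 \<in> range (\<lambda>j. (1 - p ^ j * y) * (1 - p ^ (j + 1) / y))"
    using j[symmetric] by (rule range_eqI)
  ultimately show "theta p y = 0" by (rule iffD2)
qed

text \<open>The zeros are closed under quotients, being the powers of one number. This will supply a
  suitable pair of interpolation nodes.\<close>

lemma theta_zero_divide:
  assumes p: "norm p < 1" and "x \<noteq> 0" "y \<noteq> 0" "theta p x = 0" "theta p y = 0"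
  shows "theta p (x / y) = 0"
proof -
  obtain m n k l where "p ^ m * x = p ^ n" "p ^ n \<noteq> 0" "p ^ k * y = p ^ l" "p ^ l \<noteq> 0"
    using assms by (metis theta_eq_0_iff)
  moreover from this have "p ^ k \<noteq> 0" by (metis mult_zero_left)
  ultimately have "p ^ (m + l) * x = p ^ (n + k) * y" "p ^ (n + k) \<noteq> 0"
    unfolding power_add by (metis mult.assoc mult.commute, simp)
  then have "p ^ (m + l) * (x / y) = p ^ (n + k)" "p ^ (n + k) \<noteq> 0"
    using \<open>y \<noteq> 0\<close> by (simp_all add: field_simps)
  moreover have "x / y \<noteq> 0" using assms by simp
  ultimately show ?thesis
    using theta_eq_0_iff[OF p] by blast
qed

section \<open>The rank-two kernel and Weierstrass' addition formula\<close>

lemma infsum_product_form: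
  fixes f :: "'a \<Rightarrow> complex" and g :: "'b \<Rightarrow> complex"
  assumes "(\<lambda>(i, j). f i * g j) summable_on UNIV"
  shows "(\<Sum>\<^sub>\<infinity>(i, j). f i * g j) = (\<Sum>\<^sub>\<infinity>i. f i) * (\<Sum>\<^sub>\<infinity>j. g j)"
  using infsum_Sigma_banach[of "\<lambda>(i, j). f i * g j" UNIV "\<lambda>_. UNIV"] assms
  by (simp add: infsum_cmult_right' infsum_cmult_left')

text \<open>Multiply the two series, with indices \<open>m\<close> and \<open>n\<close>, and split
  by the parity \<open>e\<close> of \<open>m + n\<close>. After putting \<open>m = i + j + e\<close>
  and \<open>n = i - j\<close>, the exponent \<open>tri m + tri n\<close> is
  \<open>i * (i + e - 1) + j * (j + e)\<close>, the power of \<open>x\<close> depends on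
  \<open>i\<close> alone and that of \<open>b\<close> on \<open>j\<close> alone. Each parity class
  is thus a function of \<open>x\<close> times a function of \<open>b\<close>.\<close>

lemma theta_product_rank_two:
  assumes p: "norm p < 1" and s: "s \<noteq> 0"
  obtains \<alpha> \<beta> :: "int \<Rightarrow> complex \<Rightarrow> complex" where
    "\<And>x b. x \<noteq> 0 \<Longrightarrow> b \<noteq> 0 \<Longrightarrow>
       theta p (x / b) * theta p (x * b / s) = \<alpha> 0 x * \<beta> 0 b + \<alpha> 1 x * \<beta> 1 b"
proof -
  obtain K where K: "\<And>x. x \<noteq> 0 \<Longrightarrow> ((\<lambda>k. K * (theta_coeff p k * x powi k)) has_sum theta p x) UNIV"
    using jacobi_triple_product[OF p] by blast
  define G where "G e x i = K ^ 2 * (-1) powi e * p ^ nat (i * (i + e - 1)) * x powi (2 * i + e) * s powi (- i)"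
    for e i x
  define H where "H e b j = p ^ nat (j * (j + e)) * b powi (- 2 * j - e) * s powi j" for e j b
  have "theta p (x / b) * theta p (x * b / s)
      = infsum (G 0 x) UNIV * infsum (H 0 b) UNIV + infsum (G 1 x) UNIV * infsum (H 1 b) UNIV"
    if x: "x \<noteq> 0" and b: "b \<noteq> 0" for x b
  proof -
    define F where "F = (\<lambda>(m, n). K * (theta_coeff p m * (x / b) powi m) * (K * (theta_coeff p n * (x * b / s) powi n)))"
    have F: "(F has_sum theta p (x / b) * theta p (x * b / s)) UNIV"
      using has_sum_product[OF K[of "x / b"] K[of "x * b / s"]] x b s by (simp add: F_def)
    define E where "E e = {(m, n). (m + n) mod 2 = (e::int)}" for e
    have part: "(F has_sum infsum (G e x) UNIV * infsum (H e b) UNIV) (E e)" if e: "e \<in> {0, 1}" for e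
    proof -
      have "F summable_on E e"
        using has_sum_imp_summable[OF F] summable_on_subset_banach by blast
      then have sumE: "(F has_sum infsum F (E e)) (E e)" by (rule has_sum_infsum)
      also have "?this \<longleftrightarrow> ((\<lambda>(i, j). G e x i * H e b j) has_sum infsum F (E e)) UNIV"
      proof (rule has_sum_reindex_bij_witness[of _ "\<lambda>(i, j). (i + j + e, i - j)"
            "\<lambda>(m, n). ((m + n - e) div 2, (m - n - e) div 2)"])
        fix mn assume mn: "mn \<in> E e"
        obtain m n where mn_eq: "mn = (m, n)" by fastforce
        have "(m + n) mod 2 = e" using mn by (simp add: E_def mn_eq)
        then have "m + n = 2 * ((m + n) div 2) + e" by presburger
        then obtain i where i: "m + n = 2 * i + e" by blast
        define j where "j = i - n"
        have m: "m = i + j + e" and n: "n = i - j" using i by (auto simp: j_def)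
        have ij: "(m + n - e) div 2 = i" "(m - n - e) div 2 = j"
          unfolding m n by auto
        show "(case case mn of (m, n) \<Rightarrow> ((m + n - e) div 2, (m - n - e) div 2) of
             (i, j) \<Rightarrow> (i + j + e, i - j)) = mn"
          using ij m n by (simp add: mn_eq)
        have i0: "i * (i + e - 1) \<ge> 0" and j0: "j * (j + e) \<ge> 0"
          using e by (auto simp: mult_nonneg_nonneg mult_nonpos_nonpos zero_le_mult_iff)
        have "2 * int (tri m + tri n) = 2 * int (nat (i * (i + e - 1)) + nat (j * (j + e)))"
          unfolding of_nat_add distrib_left two_tri using i0 j0 e
          by (auto simp: m n algebra_simps)
        then have "tri m + tri n = nat (i * (i + e - 1)) + nat (j * (j + e))"
          by (simp only: mult_cancel_left of_nat_eq_iff) simp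
        then have P: "p ^ tri m * p ^ tri n = p ^ nat (i * (i + e - 1)) * p ^ nat (j * (j + e))"
          by (simp flip: power_add)
        have "(-1::complex) powi m * (-1) powi n = (-1) powi (2 * i + e)"
          using i by (simp flip: power_int_add)
        also have "\<dots> = (-1) powi e"
          by (simp add: power_int_add power_int_mult)
        finally have M: "(-1::complex) powi m * (-1) powi n = (-1) powi e" .
        have X: "x powi m * x powi n = x powi (2 * i + e)"
          using x i by (simp flip: power_int_add)
        have B: "b powi n / b powi m = b powi (- 2 * j - e)"
          using b by (simp add: m n flip: power_int_diff)
        have S: "1 / s powi n = s powi (- i) * s powi j"
          using s by (simp add: n power_int_diff power_int_minus field_simps)
        have "F mn = K ^ 2 * ((-1) powi m * (-1) powi n) * (p ^ tri m * p ^ tri n)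
            * (x powi m * x powi n) * (b powi n / b powi m) * (1 / s powi n)"
          by (simp add: F_def mn_eq theta_coeff_def power_int_divide_distrib power_int_mult_distrib power2_eq_square)
        also have "\<dots> = G e x i * H e b j"
          unfolding M P X B S G_def H_def by (simp only: mult_ac)
        finally show "(case case mn of (m, n) \<Rightarrow> ((m + n - e) div 2, (m - n - e) div 2) of
             (i, j) \<Rightarrow> G e x i * H e b j) = F mn"
          using ij by (simp add: mn_eq)
      next
        fix ij :: "int \<times> int"
        show "(case case ij of (i, j) \<Rightarrow> (i + j + e, i - j) of
            (m, n) \<Rightarrow> ((m + n - e) div 2, (m - n - e) div 2)) = ij"
          by (cases ij) auto
        show "(case ij of (i, j) \<Rightarrow> (i + j + e, i - j)) \<in> E e"
        proof (cases ij)
          case (Pair i j)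
          have "(i + j + e + (i - j)) mod 2 = e" using e by auto
          then show ?thesis by (simp add: E_def Pair)
        qed
      qed auto
      finally have GH: "((\<lambda>(i, j). G e x i * H e b j) has_sum infsum F (E e)) UNIV" .
      then have "infsum F (E e) = (\<Sum>\<^sub>\<infinity>(i, j). G e x i * H e b j)"
        by (simp add: infsumI)
      \<comment> \<open>Summability is at hand for the family of products, not for \<open>G\<close>
        and \<open>H\<close> separately; hence the form of
        \<open>infsum_product_form\<close>.\<close>
      also have "\<dots> = infsum (G e x) UNIV * infsum (H e b) UNIV"
        by (rule infsum_product_form) (rule has_sum_imp_summable[OF GH])
      finally show ?thesis using sumE by simp
    qed
    have "(F has_sum infsum (G 0 x) UNIV * infsum (H 0 b) UNIV + infsum (G 1 x) UNIV * infsum (H 1 b) UNIV)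
        (E 0 \<union> E 1)"
      by (rule has_sum_Un_disjoint[OF part part]) (auto simp: E_def)
    also have "E 0 \<union> E 1 = UNIV"
      by (auto simp: E_def)
    finally show ?thesis using F has_sum_unique by blast
  qed
  then show ?thesis
    by (rule that[of "\<lambda>e x. infsum (G e x) UNIV" "\<lambda>e b. infsum (H e b) UNIV"])
qed

definition theta_pair :: "complex \<Rightarrow> complex \<Rightarrow> complex \<Rightarrow> complex \<Rightarrow> complex" where
  "theta_pair p s b x = theta p (x / b) * theta p (x * b / s)"

lemma theta_pair_self: "norm p < 1 \<Longrightarrow> b \<noteq> 0 \<Longrightarrow> theta_pair p s b b = 0"
  by (simp add: theta_pair_def theta_one)

text \<open>The matrix with rows \<open>b\<close>, \<open>u\<close>, \<open>w\<close> and columns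
  \<open>x\<close>, \<open>u\<close>, \<open>w\<close> has rank at most two. Its determinant,
  expanded along the row \<open>b\<close>, is zero; the entries at \<open>(u, u)\<close> and
  \<open>(w, w)\<close> vanish, which leaves three products.\<close>

lemma weierstrass_addition:
  assumes p: "norm p < 1" and nz: "s \<noteq> 0" "x \<noteq> 0" "b \<noteq> 0" "u \<noteq> 0" "w \<noteq> 0"
  shows "theta_pair p s b x * theta_pair p s u w * theta_pair p s w u
    = theta_pair p s b u * theta_pair p s u w * theta_pair p s w x
      + theta_pair p s b w * theta_pair p s u x * theta_pair p s w u"
proof -
  let ?F = "theta_pair p s"
  obtain \<alpha> \<beta> :: "int \<Rightarrow> complex \<Rightarrow> complex" where rank: "\<And>x b. x \<noteq> 0 \<Longrightarrow> b \<noteq> 0 \<Longrightarrow> ?F b x = \<alpha> 0 x * \<beta> 0 b + \<alpha> 1 x * \<beta> 1 b"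
    using theta_product_rank_two[OF p nz(1)] unfolding theta_pair_def by metis
  have "?F b x * (?F u u * ?F w w - ?F u w * ?F w u) - ?F b u * (?F u x * ?F w w - ?F u w * ?F w x)
      + ?F b w * (?F u x * ?F w u - ?F u u * ?F w x) = 0"
    unfolding rank[OF nz(2,3)] rank[OF nz(2,4)] rank[OF nz(2,5)] rank[OF nz(4,3)] rank[OF nz(4,4)]
      rank[OF nz(4,5)] rank[OF nz(5,3)] rank[OF nz(5,4)] rank[OF nz(5,5)]
    by (simp add: algebra_simps)
  then show ?thesis
    unfolding theta_pair_self[OF p nz(4)] theta_pair_self[OF p nz(5)] by (simp add: algebra_simps)
qed

lemma theta_pair_interpolation:
  assumes p: "norm p < 1" and nz: "s \<noteq> 0" "x \<noteq> 0" "b \<noteq> 0" "u \<noteq> 0" "w \<noteq> 0"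
    and "theta p (u / w) \<noteq> 0" "theta p (u * w / s) \<noteq> 0"
  shows "theta_pair p s b x = theta_pair p s b u / theta_pair p s w u * theta_pair p s w x
      + theta_pair p s b w / theta_pair p s u w * theta_pair p s u x"
proof -
  have "theta p (w / u) \<noteq> 0"
    using theta_swap[OF p nz(4,5)] nz assms(7) by auto
  then have "theta_pair p s u w \<noteq> 0" "theta_pair p s w u \<noteq> 0"
    using assms by (auto simp: theta_pair_def mult.commute)
  then show ?thesis
    using weierstrass_addition[OF p nz] by (simp add: field_simps)
qed

text \<open>A Lagrange basis for theta functions. Like a product of factors
  \<open>theta p (x / z)\<close> over \<open>card B\<close> parameters \<open>z\<close> with product
  \<open>S\<close>, it has one theta factor in \<open>x\<close> per node: these vanish at the nodes
  other than \<open>b\<close> and at the one further point that makes the product of these zeros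
  \<open>S\<close>. The denominators normalise the value at \<open>b\<close> to 1.\<close>

definition lagrange_coeff :: "complex \<Rightarrow> complex \<Rightarrow> complex set \<Rightarrow> complex \<Rightarrow> complex \<Rightarrow> complex" where
  "lagrange_coeff p S B x b = theta p (x * \<Prod>(B - {b}) / S) / theta p (\<Prod>B / S)
     * (\<Prod>b'\<in>B - {b}. theta p (x / b') / theta p (b / b'))"

text \<open>Removing \<open>w\<close> from \<open>B\<close> while dividing \<open>S\<close> by
  \<open>w\<close> leaves the leading quotient unchanged, so only the factor belonging to the node
  \<open>w\<close> is lost.\<close>

lemma lagrange_coeff_remove:
  assumes "finite B" "w \<in> B" "b \<in> B" "b \<noteq> w" "w \<noteq> 0" "theta p (b / w) \<noteq> 0"
  shows "theta p (x / w) * lagrange_coeff p (S / w) (B - {w}) x b = lagrange_coeff p S B x b * theta p (b / w)"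
proof -
  have diff: "B - {b} - {w} = B - {w} - {b}" by blast
  have B: "\<Prod>B = w * \<Prod>(B - {w})" "\<Prod>(B - {b}) = w * \<Prod>(B - {w} - {b})"
    using assms prod.remove[of B w "\<lambda>y. y"] prod.remove[of "B - {b}" w "\<lambda>y. y"] unfolding diff by auto
  have P: "(\<Prod>b'\<in>B - {b}. theta p (x / b') / theta p (b / b'))
      = theta p (x / w) / theta p (b / w) * (\<Prod>b'\<in>B - {w} - {b}. theta p (x / b') / theta p (b / b'))"
    using assms prod.remove[of "B - {b}" w "\<lambda>b'. theta p (x / b') / theta p (b / b')"] unfolding diff by auto
  show ?thesis
    using assms unfolding lagrange_coeff_def B P by (simp add: mult_ac)
qed

text \<open>
  Weierstrass' addition formula, applied to the factors of two of the \<open>z\<close>'s, writes both sides as the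
  same combination of two instances with one node and one \<open>z\<close> fewer.
\<close>

proposition theta_interpolation:
  assumes p: "norm p < 1" and x: "x \<noteq> 0"
    and "finite B" "B \<noteq> {}" "0 \<notin> B" "0 \<notin> set zs" "length zs = card B"
    and "\<And>b b'. b \<in> B \<Longrightarrow> b' \<in> B \<Longrightarrow> b \<noteq> b' \<Longrightarrow> theta p (b / b') \<noteq> 0"
    and "theta p (\<Prod>B / prod_list zs) \<noteq> 0"
  shows "(\<Prod>z\<leftarrow>zs. theta p (x / z))
    = (\<Sum>b\<in>B. lagrange_coeff p (prod_list zs) B x b * (\<Prod>z\<leftarrow>zs. theta p (b / z)))"
  using assms(3-)
proof (induction "length zs" arbitrary: zs B rule: less_induct)
  case less
  define S where "S = prod_list zs"
  have "zs \<noteq> []" using less.prems by auto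
  then obtain z1 zs1 where zs1: "zs = z1 # zs1" by (cases zs) auto
  show ?case
  proof (cases zs1)
    case Nil
    then have "card B = 1" using zs1 less.prems by simp
    then obtain b where "B = {b}" using card_1_singletonE by blast
    then show ?thesis
      using less.prems zs1 Nil by (simp add: lagrange_coeff_def)
  next
    case (Cons z2 rest)
    then have zs: "zs = z1 # z2 # rest" using zs1 by simp
    define s where "s = z1 * z2"
    have nz: "z1 \<noteq> 0" "z2 \<noteq> 0" "s \<noteq> 0" using less.prems zs by (auto simp: s_def)
    have card: "card B = length rest + 2" using less.prems zs by simp
    \<comment> \<open>With two nodes this is the hypothesis on \<open>\<Prod>B\<close>. With three
      or more, if \<open>theta p (b1 * b2 / s)\<close> and \<open>theta p (b1 * b3 / s)\<close> were
      both 0, then so would be \<open>theta p (b2 / b3)\<close>, contrary to the separation of the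
      nodes.\<close>
    obtain u w where uw: "u \<in> B" "w \<in> B" "u \<noteq> w" "theta p (u * w / s) \<noteq> 0"
    proof (cases "rest = []")
      case True
      then have "card B = 2" using card by simp
      then obtain u w where "B = {u, w}" "u \<noteq> w" by (meson card_2_iff)
      then show ?thesis
        using less.prems(7) that[of u w] zs True by (simp add: s_def)
    next
      case False
      then have "card B \<ge> 3" using card by (cases rest) auto
      then obtain T where "T \<subseteq> B" "card T = 3" by (meson obtain_subset_with_card_n)
      then obtain b1 b2 b3 where b: "b1 \<in> B" "b2 \<in> B" "b3 \<in> B" "b1 \<noteq> b2" "b2 \<noteq> b3" "b1 \<noteq> b3"
        by (auto simp: card_3_iff)
      have b0: "b1 \<noteq> 0" "b2 \<noteq> 0" "b3 \<noteq> 0" using b less.prems by auto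
      have "\<not> (theta p (b1 * b2 / s) = 0 \<and> theta p (b1 * b3 / s) = 0)"
        using theta_zero_divide[OF p, of "b1 * b2 / s" "b1 * b3 / s"] b0 nz less.prems(6)[OF b(2,3,5)]
        by auto
      then show ?thesis using that b by blast
    qed
    have uw0: "u \<noteq> 0" "w \<noteq> 0" using uw less.prems by auto
    define R where "R y = (\<Prod>z\<leftarrow>rest. theta p (y / z))" for y
    have full: "(\<Prod>z\<leftarrow>zs. theta p (y / z)) = theta_pair p s z1 y * R y" for y
      using nz by (simp add: zs R_def theta_pair_def s_def)
    \<comment> \<open>The induction hypothesis for the nodes without \<open>v\<close>, with
      \<open>z1\<close> and \<open>z2\<close> replaced by the single \<open>s / v\<close>,
      multiplied by \<open>theta p (x / v)\<close>. The missing term \<open>b = v\<close> may be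
      added since \<open>theta_pair p s v v = 0\<close>.\<close>
    have reduced: "theta_pair p s v x * R x
        = (\<Sum>b\<in>B. lagrange_coeff p S B x b * (theta_pair p s v b * R b))" if v: "v \<in> B" for v
    proof -
      have v0: "v \<noteq> 0" using v less.prems by auto
      define zs' where "zs' = s / v # rest"
      have S': "prod_list zs' = S / v" by (simp add: zs'_def S_def zs s_def)
      have zs'_prod: "(\<Prod>z\<leftarrow>zs'. theta p (y / z)) = theta p (y * v / s) * R y" for y
        using v0 by (simp add: zs'_def R_def)
      have PB: "\<Prod>B = v * \<Prod>(B - {v})" using v less.prems by (simp add: prod.remove)
      have "(\<Prod>z\<leftarrow>zs'. theta p (x / z))
          = (\<Sum>b\<in>B - {v}. lagrange_coeff p (prod_list zs') (B - {v}) x b * (\<Prod>z\<leftarrow>zs'. theta p (b / z)))"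
      proof (rule less.hyps)
        show "length zs' = card (B - {v})"
          using v card less.prems by (simp add: zs'_def)
        then show "B - {v} \<noteq> {}" unfolding zs'_def by (metis card.empty length_Cons nat.distinct(1))
        have "\<Prod>(B - {v}) / (S / v) = \<Prod>B / S" using v0 PB by simp
        then show "theta p (\<Prod>(B - {v}) / prod_list zs') \<noteq> 0"
          using less.prems(7) by (simp only: S' S_def not_False_eq_True)
      qed (use less.prems v0 nz in \<open>auto simp: zs'_def zs\<close>)
      then have "theta p (x * v / s) * R x
          = (\<Sum>b\<in>B - {v}. lagrange_coeff p (S / v) (B - {v}) x b * (theta p (b * v / s) * R b))"
        unfolding zs'_prod S' .
      then have "theta_pair p s v x * R x
          = (\<Sum>b\<in>B - {v}. theta p (x / v) * lagrange_coeff p (S / v) (B - {v}) x b * (theta p (b * v / s) * R b))"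
        by (simp add: theta_pair_def sum_distrib_left mult.assoc)
      also have "\<dots> = (\<Sum>b\<in>B - {v}. lagrange_coeff p S B x b * (theta_pair p s v b * R b))"
        by (rule sum.cong[OF refl], subst lagrange_coeff_remove)
           (use less.prems v v0 in \<open>auto simp: theta_pair_def mult_ac\<close>)
      also have "\<dots> = (\<Sum>b\<in>B. lagrange_coeff p S B x b * (theta_pair p s v b * R b))"
        using less.prems v theta_pair_self[OF p v0] by (simp add: sum.remove[of B v])
      finally show ?thesis .
    qed
    have expand: "theta_pair p s z1 y = theta_pair p s z1 u / theta_pair p s w u * theta_pair p s w y
      + theta_pair p s z1 w / theta_pair p s u w * theta_pair p s u y" if "y \<noteq> 0" for y
      using theta_pair_interpolation[OF p nz(3) that nz(1) uw0] uw less.prems by blast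
    have "(\<Prod>z\<leftarrow>zs. theta p (x / z))
      = theta_pair p s z1 u / theta_pair p s w u * (theta_pair p s w x * R x)
      + theta_pair p s z1 w / theta_pair p s u w * (theta_pair p s u x * R x)"
      unfolding full expand[OF x] by (simp add: algebra_simps)
    also have "\<dots> = (\<Sum>b\<in>B. lagrange_coeff p S B x b * (theta_pair p s z1 b * R b))"
      unfolding reduced[OF uw(1)] reduced[OF uw(2)] sum_distrib_left sum.distrib[symmetric]
    proof (rule sum.cong[OF refl])
      fix b assume "b \<in> B"
      then have "b \<noteq> 0" using less.prems by auto
      show "theta_pair p s z1 u / theta_pair p s w u * (lagrange_coeff p S B x b * (theta_pair p s w b * R b))
        + theta_pair p s z1 w / theta_pair p s u w * (lagrange_coeff p S B x b * (theta_pair p s u b * R b))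
        = lagrange_coeff p S B x b * (theta_pair p s z1 b * R b)"
        unfolding expand[OF \<open>b \<noteq> 0\<close>] by (simp add: algebra_simps)
    qed
    finally show ?thesis unfolding full S_def .
  qed
qed

section \<open>The vanishing theorem\<close>

definition vandermonde :: "complex \<Rightarrow> nat \<Rightarrow> (nat \<Rightarrow> int \<Rightarrow> complex) \<Rightarrow> (nat \<Rightarrow> int) \<Rightarrow> complex" where
  "vandermonde p r c k =
     (\<Prod>i=1..r. \<Prod>j=i+1..r. theta p (c i (k i) / c j (k j))) * (\<Prod>j=1..r. c j (k j) ^ j)"

lemma theta_block_eq_0:
  assumes "norm p < 1" "i \<in> {1..r}" "c i (k i) \<noteq> 0"
  shows "theta_block p r c k (c i (k i)) = 0"
  using assms theta_one[of p] by (auto simp: theta_block_def intro!: bexI[of _ i])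

lemma theta_block_upd:
  assumes "i \<in> {1..r}"
  shows "theta_block p r c (k(i := s)) x
    = theta p (x * c i s * (\<Prod>j\<in>{1..r} - {i}. c j (k j))) * theta p (x / c i s)
      * (\<Prod>j\<in>{1..r} - {i}. theta p (x / c j (k j)))"
proof -
  have "(\<Prod>j=1..r. h j ((k(i := s)) j)) = h i s * (\<Prod>j\<in>{1..r} - {i}. h j (k j))"
    for h :: "nat \<Rightarrow> int \<Rightarrow> complex"
  proof -
    have "(\<Prod>j\<in>{1..r} - {i}. h j ((k(i := s)) j)) = (\<Prod>j\<in>{1..r} - {i}. h j (k j))"
      by (intro prod.cong) auto
    then show ?thesis using assms by (subst prod.remove[of _ i]) auto
  qed
  from this[of c] this[of "\<lambda>j y. theta p (x / c j y)"] show ?thesis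
    unfolding theta_block_def cprod_def by (simp add: mult.assoc)
qed

lemma prod_upper_triangle_remove:
  fixes h :: "nat \<Rightarrow> nat \<Rightarrow> 'a::comm_monoid_mult"
  assumes i: "i \<in> {1..r}"
  shows "(\<Prod>a=1..r. \<Prod>b=a+1..r. h a b)
    = (\<Prod>a\<in>{1..<i}. h a i) * (\<Prod>b\<in>{i+1..r}. h i b) * (\<Prod>a\<in>{1..r} - {i}. \<Prod>b\<in>{a+1..r} - {i}. h a b)"
proof -
  have "(\<Prod>b=a+1..r. h a b) = (if a < i then h a i else 1) * (\<Prod>b\<in>{a+1..r} - {i}. h a b)" for a
    using i by (cases "a < i") (auto simp: prod.remove[of _ i])
  then have "(\<Prod>a\<in>{1..r} - {i}. \<Prod>b=a+1..r. h a b)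
    = (\<Prod>a\<in>{1..r} - {i}. if a < i then h a i else 1) * (\<Prod>a\<in>{1..r} - {i}. \<Prod>b\<in>{a+1..r} - {i}. h a b)"
    by (simp add: prod.distrib)
  also have "(\<Prod>a\<in>{1..r} - {i}. if a < i then h a i else 1) = (\<Prod>a\<in>{1..<i}. h a i)"
    using i by (intro prod.mono_neutral_cong_right) auto
  finally show ?thesis
    using i by (subst prod.remove[of "{1..r}" i]) (simp_all add: mult_ac)
qed

text \<open>Here the powers \<open>c j (k j) ^ j\<close> do their work. With
  \<open>u = c i s\<close>, inverting the arguments of the \<open>i - 1\<close> factors
  \<open>theta p (c a (k a) / u)\<close>, \<open>a < i\<close>, costs a factor \<open>1 / u\<close>
  each; against \<open>u ^ i\<close> this leaves exactly one \<open>u\<close>, for every position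
  \<open>i\<close>.\<close>

lemma vandermonde_upd:
  assumes p: "norm p < 1" and i: "i \<in> {1..r}" and c: "\<And>j k. j \<in> {1..r} \<Longrightarrow> c j k \<noteq> 0"
  shows "\<exists>W. \<forall>s. vandermonde p r c (k(i := s))
    = W * c i s * (\<Prod>j\<in>{1..r} - {i}. theta p (c i s / c j (k j)))"
proof -
  define R where "R = (\<Prod>a\<in>{1..r} - {i}. \<Prod>b\<in>{a+1..r} - {i}. theta p (c a (k a) / c b (k b)))"
  define Q where "Q = (\<Prod>j\<in>{1..r} - {i}. c j (k j) ^ j)"
  define N where "N = (\<Prod>a\<in>{1..<i}. - c a (k a))"
  have "vandermonde p r c (k(i := s)) = (N * R * Q) * c i s * (\<Prod>j\<in>{1..r} - {i}. theta p (c i s / c j (k j)))"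
    for s
  proof -
    define u where "u = c i s"
    have u: "u \<noteq> 0" using c i by (simp add: u_def)
    have "(\<Prod>a=1..r. \<Prod>b=a+1..r. theta p (c a ((k(i := s)) a) / c b ((k(i := s)) b)))
      = (\<Prod>a\<in>{1..<i}. theta p (c a (k a) / u)) * (\<Prod>b\<in>{i+1..r}. theta p (u / c b (k b))) * R"
      unfolding prod_upper_triangle_remove[OF i] R_def u_def
      by (intro arg_cong2[of _ _ _ _ "(*)"] prod.cong) auto
    also have "(\<Prod>a\<in>{1..<i}. theta p (c a (k a) / u)) = (\<Prod>a\<in>{1..<i}. - c a (k a) * (1 / u) * theta p (u / c a (k a)))"
    proof (rule prod.cong[OF refl])
      fix a assume "a \<in> {1..<i}"
      then have "c a (k a) \<noteq> 0" using c i by auto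
      then show "theta p (c a (k a) / u) = - c a (k a) * (1 / u) * theta p (u / c a (k a))"
        using theta_swap[OF p u, of "c a (k a)"] u by (simp add: field_simps)
    qed
    also have "\<dots> = N * (1 / u) ^ (i - 1) * (\<Prod>a\<in>{1..<i}. theta p (u / c a (k a)))"
      by (simp only: prod.distrib prod_constant card_atLeastLessThan N_def)
    finally have D: "(\<Prod>a=1..r. \<Prod>b=a+1..r. theta p (c a ((k(i := s)) a) / c b ((k(i := s)) b)))
      = N * (1 / u) ^ (i - 1) * ((\<Prod>a\<in>{1..<i}. theta p (u / c a (k a))) * (\<Prod>b\<in>{i+1..r}. theta p (u / c b (k b)))) * R"
      by (simp add: mult_ac)
    have split: "{1..r} - {i} = {1..<i} \<union> {i+1..r}" using i by auto
    have U: "(\<Prod>j\<in>{1..r} - {i}. theta p (u / c j (k j)))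
      = (\<Prod>a\<in>{1..<i}. theta p (u / c a (k a))) * (\<Prod>b\<in>{i+1..r}. theta p (u / c b (k b)))"
      unfolding split by (rule prod.union_disjoint) auto
    have "(\<Prod>j\<in>{1..r} - {i}. c j ((k(i := s)) j) ^ j) = Q"
      unfolding Q_def by (intro prod.cong) auto
    then have P: "(\<Prod>j=1..r. c j ((k(i := s)) j) ^ j) = u ^ i * Q"
      using i by (subst prod.remove[of _ i]) (auto simp: u_def)
    have "u ^ i = u * u ^ (i - 1)" using i by (cases i) auto
    then have "(1 / u) ^ (i - 1) * u ^ i = u"
      using u by (simp add: power_divide)
    then show ?thesis
      unfolding vandermonde_def D P U[symmetric] u_def[symmetric] by (simp add: mult_ac)
  qed
  then show ?thesis by blast
qed

text \<open>By the update formulas the left side is symmetric in \<open>s\<close> and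
  \<open>t\<close> except for \<open>c i s * theta p (c i t / c i s)\<close>, which changes sign by
  \<open>theta_swap\<close>.\<close>

lemma vandermonde_block_antisym:
  assumes p: "norm p < 1" and i: "i \<in> {1..r}" and c: "\<And>j k. j \<in> {1..r} \<Longrightarrow> c j k \<noteq> 0"
  shows "vandermonde p r c (k(i := s)) * theta_block p r c (k(i := s)) (c i t)
    = - (vandermonde p r c (k(i := t)) * theta_block p r c (k(i := t)) (c i s))"
proof -
  define P where "P s = (\<Prod>j\<in>{1..r} - {i}. theta p (c i s / c j (k j)))" for s
  define C where "C = (\<Prod>j\<in>{1..r} - {i}. c j (k j))"
  obtain W where W: "\<And>s. vandermonde p r c (k(i := s)) = W * c i s * P s"
    using vandermonde_upd[OF p i, of c k] c unfolding P_def by blast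
  have E: "vandermonde p r c (k(i := s)) * theta_block p r c (k(i := s)) (c i t)
    = W * P s * P t * theta p (c i s * c i t * C) * (c i s * theta p (c i t / c i s))" for s t
    unfolding W theta_block_upd[OF i] P_def[symmetric] C_def[symmetric]
    by (simp only: mult_ac)
  have "c i s * theta p (c i t / c i s) = - (c i t * theta p (c i s / c i t))"
    using theta_swap[OF p, of "c i s" "c i t"] c i by auto
  then show ?thesis
    unfolding E[of s t] E[of t s] by (simp add: mult_ac)
qed

text \<open>A block is a product of \<open>r + 1\<close> theta functions with parameters
  \<open>1 / cprod r c k\<close> and the \<open>c j (k j)\<close>. The product of these is 1 for
  every \<open>k\<close>, so the coefficients are the same for all \<open>k\<close>.\<close>

lemma theta_block_interpolation:
  assumes p: "norm p < 1" and x: "x \<noteq> 0" and c: "\<And>j. j \<in> {1..r} \<Longrightarrow> c j (k j) \<noteq> 0"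
    and "finite B" "0 \<notin> B" "card B = Suc r"
    and "\<And>b b'. b \<in> B \<Longrightarrow> b' \<in> B \<Longrightarrow> b \<noteq> b' \<Longrightarrow> theta p (b / b') \<noteq> 0"
    and "theta p (\<Prod>B) \<noteq> 0"
  shows "theta_block p r c k x = (\<Sum>b\<in>B. lagrange_coeff p 1 B x b * theta_block p r c k b)"
proof -
  define ys where "ys = map (\<lambda>j. c j (k j)) [1..<Suc r]"
  have ys: "prod_list (map h ys) = (\<Prod>j=1..r. h (c j (k j)))" for h :: "complex \<Rightarrow> complex"
    unfolding ys_def by (simp add: prod.distinct_set_conv_list[symmetric] o_def atLeastLessThanSuc_atLeastAtMost del: upt_Suc)
  have C: "cprod r c k \<noteq> 0"
    using c by (simp add: cprod_def)
  define zs where "zs = 1 / cprod r c k # ys"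
  have block: "theta_block p r c k y = (\<Prod>z\<leftarrow>zs. theta p (y / z))" for y
    using C by (simp add: zs_def ys theta_block_def)
  have "prod_list zs = 1"
    using C ys[of "\<lambda>y. y"] by (simp add: zs_def cprod_def)
  moreover have "0 \<notin> set zs" "length zs = card B"
    using C c assms by (auto simp: zs_def ys_def)
  moreover have "B \<noteq> {}" using assms by auto
  ultimately show ?thesis
    using theta_interpolation[OF p x, of B zs] assms unfolding block by simp
qed

section \<open>Vanishing of sums over boxes\<close>

locale nonvanishing =
  fixes p :: complex and r :: nat and c :: "nat \<Rightarrow> int \<Rightarrow> complex"
  assumes p: "norm p < 1"
    and c: "\<And>j k. j \<in> {1..r} \<Longrightarrow> c j k \<noteq> 0"
    and block_nonzero: "\<And>k i t. k \<in> multi_indices r \<Longrightarrow> i \<in> {1..r} \<Longrightarrow> t \<noteq> k i \<Longrightarrow>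
      theta_block p r c k (c i t) \<noteq> 0"
    and ratio_nonzero: "\<And>k i j. k \<in> multi_indices r \<Longrightarrow> i \<in> {1..r} \<Longrightarrow> j \<in> {i+1..r} \<Longrightarrow>
      theta p (c i (k i) / c j (k j)) \<noteq> 0"
begin

lemma vandermonde_nonzero: "k \<in> multi_indices r \<Longrightarrow> vandermonde p r c k \<noteq> 0"
  using ratio_nonzero c by (auto simp: vandermonde_def)

lemma ratio_nonzero':
  assumes "k \<in> multi_indices r" "i \<in> {1..r}" "j \<in> {1..r}" "i \<noteq> j"
  shows "theta p (c i (k i) / c j (k j)) \<noteq> 0"
proof (cases "i < j")
  case True
  then show ?thesis using ratio_nonzero assms by auto
next
  case False
  then have "theta p (c j (k j) / c i (k i)) \<noteq> 0" using ratio_nonzero assms by auto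
  then show ?thesis
    using theta_swap[OF p, of "c j (k j)" "c i (k i)"] c assms by auto
qed

text \<open>The nodes come from one reference index \<open>k0\<close> and one extra value
  \<open>c i t\<close>. That the single block of \<open>k0\<close> at \<open>c i t\<close> is
  nonzero separates \<open>c i t\<close> from the other nodes and gives the condition on their
  product; \<open>k\<close> itself remains free.\<close>

lemma block_interpolation:
  assumes k0: "k0 \<in> multi_indices r" and i: "i \<in> {1..r}" and t: "t \<noteq> k0 i" and x: "x \<noteq> 0"
  defines "B \<equiv> insert (c i t) ((\<lambda>j. c j (k0 j)) ` {1..r})"
  shows "theta_block p r c k x = (\<Sum>b\<in>B. lagrange_coeff p 1 B x b * theta_block p r c k b)"
proof (rule theta_block_interpolation[OF p x])
  have t_nz: "theta p (c i t * cprod r c k0) \<noteq> 0" "\<And>j. j \<in> {1..r} \<Longrightarrow> theta p (c i t / c j (k0 j)) \<noteq> 0"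
    using block_nonzero[OF k0 i t] by (auto simp: theta_block_def)
  have t_nz': "theta p (c j (k0 j) / c i t) \<noteq> 0" if "j \<in> {1..r}" for j
    using t_nz(2)[OF that] theta_swap[OF p, of "c i t" "c j (k0 j)"] c i that by auto
  have notin: "c i t \<notin> (\<lambda>j. c j (k0 j)) ` {1..r}"
    using t_nz(2) theta_one[OF p] c by fastforce
  have inj: "inj_on (\<lambda>j. c j (k0 j)) {1..r}"
  proof (rule inj_onI)
    fix j j' assume "j \<in> {1..r}" "j' \<in> {1..r}" "c j (k0 j) = c j' (k0 j')"
    then show "j = j'"
      using ratio_nonzero'[OF k0, of j j'] theta_one[OF p] c by fastforce
  qed
  show "card B = Suc r"
    unfolding B_def using notin inj by (simp add: card_image)
  show "finite B" "0 \<notin> B" using c i by (auto simp: B_def)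
  have "\<Prod>B = c i t * cprod r c k0"
    unfolding B_def cprod_def using notin inj by (simp add: prod.reindex)
  then show "theta p (\<Prod>B) \<noteq> 0" using t_nz by simp
  show "theta p (b / b') \<noteq> 0" if "b \<in> B" "b' \<in> B" "b \<noteq> b'" for b b'
  proof -
    have "theta p (c j (k0 j) / c j' (k0 j')) \<noteq> 0"
      if "j \<in> {1..r}" "j' \<in> {1..r}" "c j (k0 j) \<noteq> c j' (k0 j')" for j j'
      using that by (intro ratio_nonzero'[OF k0]) auto
    then show ?thesis
      using that t_nz(2) t_nz' unfolding B_def by blast
  qed
qed (use c in auto)

definition box_term :: "(nat \<Rightarrow> int set) \<Rightarrow> complex list \<Rightarrow> (nat \<Rightarrow> int) \<Rightarrow> complex" where
  "box_term T xs k = (\<Prod>x\<leftarrow>xs. theta_block p r c k x)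
     / (vandermonde p r c k * (\<Prod>i=1..r. \<Prod>t\<in>T i - {k i}. theta_block p r c k (c i t)))"

lemma box_term_Cons: "box_term T (x # xs) k = theta_block p r c k x * box_term T xs k"
  by (simp add: box_term_def)

text \<open>The numerator factor at \<open>c i s\<close> is 0 if \<open>k i = s\<close>, and
  otherwise cancels the denominator factor with \<open>t = s\<close>.\<close>

lemma box_sum_remove:
  assumes "\<And>j. j \<in> {1..r} \<Longrightarrow> finite (T j)" and i: "i \<in> {1..r}" and s: "s \<in> T i"
  shows "(\<Sum>k\<in>PiE {1..r} T. box_term T (c i s # xs) k) = (\<Sum>k\<in>PiE {1..r} (T(i := T i - {s})). box_term (T(i := T i - {s})) xs k)"
proof (rule sum.mono_neutral_cong_right)
  let ?T' = "T(i := T i - {s})"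
  show "finite (PiE {1..r} T)" using assms by (intro finite_PiE) auto
  show "PiE {1..r} ?T' \<subseteq> PiE {1..r} T" using i by (intro PiE_mono) auto
  show "\<forall>k\<in>PiE {1..r} T - PiE {1..r} ?T'. box_term T (c i s # xs) k = 0"
  proof
    fix k assume k: "k \<in> PiE {1..r} T - PiE {1..r} ?T'"
    have "k i = s"
    proof (rule ccontr)
      assume "k i \<noteq> s"
      then have "k \<in> PiE {1..r} ?T'" using k by (auto simp: PiE_iff)
      then show False using k by simp
    qed
    then show "box_term T (c i s # xs) k = 0"
      using theta_block_eq_0[where c = c and k = k, OF p i] c i by (simp add: box_term_Cons)
  qed
  fix k assume k: "k \<in> PiE {1..r} ?T'"
  have "k i \<in> ?T' i" using k i by (rule PiE_mem)
  then have ks: "k i \<noteq> s" by simp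
  have km: "k \<in> multi_indices r" using k by (auto simp: multi_indices_def PiE_iff)
  let ?h = "\<lambda>T j. \<Prod>t\<in>T j - {k j}. theta_block p r c k (c j t)"
  have "?h T i = theta_block p r c k (c i s) * ?h ?T' i"
  proof -
    have "T i - {k i} - {s} = ?T' i - {k i}" by auto
    then show ?thesis
      using prod.remove[of "T i - {k i}" s "\<lambda>t. theta_block p r c k (c i t)"] assms ks by simp
  qed
  moreover have "(\<Prod>j\<in>{1..r} - {i}. ?h T j) = (\<Prod>j\<in>{1..r} - {i}. ?h ?T' j)"
    by (intro prod.cong) auto
  ultimately have "(\<Prod>j=1..r. ?h T j) = theta_block p r c k (c i s) * (\<Prod>j=1..r. ?h ?T' j)"
    using i by (simp only: prod.remove[of "{1..r}" i] finite_atLeastAtMost mult.assoc)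
  moreover have "theta_block p r c k (c i s) \<noteq> 0"
    using block_nonzero[OF km i] ks by auto
  ultimately show "box_term T (c i s # xs) k = box_term ?T' xs k"
    by (simp add: box_term_def)
qed

text \<open>The denominator has one block more than the numerator. Interpolating the first numerator
  block at nodes from the box gives sums over boxes with one point deleted and one numerator block
  fewer, so this balance persists.\<close>

proposition box_sum_zero:
  assumes "\<And>i. i \<in> {1..r} \<Longrightarrow> finite (T i)" "\<And>i. i \<in> {1..r} \<Longrightarrow> T i \<noteq> {}"
    and "(\<Sum>i=1..r. card (T i) - 1) = Suc (length xs)" and "0 \<notin> set xs"
  shows "(\<Sum>k\<in>PiE {1..r} T. box_term T xs k) = 0"
  using assms
proof (induction xs arbitrary: T)
  case Nil
  then have "(\<Sum>i=1..r. card (T i) - 1) = 1" by simp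
  \<comment> \<open>The count 1 says that one side has two points and every other side a single one,
    so the box consists of two indices.\<close>
  then have "\<exists>i\<in>{1..r}. card (T i) - 1 = 1 \<and> (\<forall>j\<in>{1..r}. i \<noteq> j \<longrightarrow> card (T j) - 1 = 0)"
    by (rule iffD1[OF sum_eq_1_iff[OF finite_atLeastAtMost]])
  then obtain i where i: "i \<in> {1..r}" and "card (T i) - 1 = 1"
    and rest: "\<forall>j\<in>{1..r}. i \<noteq> j \<longrightarrow> card (T j) - 1 = 0"
    by blast
  then have "card (T i) = 2" by simp
  then obtain s t where st: "T i = {s, t}" "s \<noteq> t" by (meson card_2_iff)
  obtain \<kappa> where \<kappa>: "\<kappa> \<in> PiE {1..r} T"
    using Nil.prems(2) PiE_eq_empty_iff[of "{1..r}" T] by auto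
  have single: "T j = {\<kappa> j}" if "j \<in> {1..r}" "j \<noteq> i" for j
  proof -
    have "card (T j) \<noteq> 0" using Nil.prems that by auto
    then have "card (T j) = 1" using rest that by fastforce
    moreover have "\<kappa> j \<in> T j" using \<kappa> that by auto
    ultimately show ?thesis by (metis card_1_singletonE singletonD)
  qed
  have box: "PiE {1..r} T = {\<kappa>(i := s), \<kappa>(i := t)}"
  proof
    show "PiE {1..r} T \<subseteq> {\<kappa>(i := s), \<kappa>(i := t)}"
    proof
      fix k assume k: "k \<in> PiE {1..r} T"
      have "k = \<kappa>(i := k i)"
      proof
        fix j
        show "k j = (\<kappa>(i := k i)) j"
        proof (cases "j \<in> {1..r} \<and> j \<noteq> i")
          case True
          then have "k j \<in> T j" using k by auto
          then show ?thesis using single True by auto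
        next
          case False
          then show ?thesis using k \<kappa> by (auto simp: PiE_iff extensional_def)
        qed
      qed
      moreover have "k i \<in> {s, t}" using k i st by auto
      ultimately show "k \<in> {\<kappa>(i := s), \<kappa>(i := t)}" by auto
    qed
    show "{\<kappa>(i := s), \<kappa>(i := t)} \<subseteq> PiE {1..r} T"
      using \<kappa> i st by (auto simp: PiE_iff extensional_def)
  qed
  have "box_term T [] (\<kappa>(i := y)) = 1 / (vandermonde p r c (\<kappa>(i := y)) * theta_block p r c (\<kappa>(i := y)) (c i z))"
    if "{y, z} = {s, t}" "y \<noteq> z" for y z
  proof -
    have "T i - {y} = {z}" using st that by auto
    moreover have "(\<Prod>j\<in>{1..r} - {i}. \<Prod>t\<in>T j - {(\<kappa>(i := y)) j}. theta_block p r c (\<kappa>(i := y)) (c j t)) = 1"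
      using single by (intro prod.neutral) auto
    ultimately show ?thesis
      using i unfolding box_term_def by (subst prod.remove[of "{1..r}" i]) simp_all
  qed
  note two = this[of s t] this[of t s]
  have "\<kappa>(i := s) \<noteq> \<kappa>(i := t)" using st by (metis fun_upd_same)
  then have "(\<Sum>k\<in>PiE {1..r} T. box_term T [] k) = box_term T [] (\<kappa>(i := s)) + box_term T [] (\<kappa>(i := t))"
    unfolding box by simp
  also have "\<dots> = 0"
    using two st(2) vandermonde_block_antisym[OF p i, of c \<kappa> s t] c
    by (simp add: insert_commute)
  finally show ?case .
next
  case (Cons x xs)
  have "\<exists>i\<in>{1..r}. card (T i) - 1 \<noteq> 0"
  proof (rule ccontr)
    assume "\<not> ?thesis"
    then have "(\<Sum>i=1..r. card (T i) - 1) = 0" by simp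
    then show False using Cons.prems by simp
  qed
  then obtain i where i: "i \<in> {1..r}" and card: "card (T i) - 1 \<noteq> 0" by blast
  obtain k0 where k0: "k0 \<in> PiE {1..r} T"
    using Cons.prems(2) PiE_eq_empty_iff[of "{1..r}" T] by auto
  then have k0m: "k0 \<in> multi_indices r" by (auto simp: multi_indices_def PiE_iff)
  have "\<not> T i \<subseteq> {k0 i}"
    using card card_mono[of "{k0 i}" "T i"] by auto
  then obtain t where t: "t \<in> T i" "t \<noteq> k0 i" by auto
  have x: "x \<noteq> 0" using Cons.prems by auto
  \<comment> \<open>All nodes have the form \<open>c j s\<close> with \<open>s\<close> in
    \<open>T j\<close>, so \<open>box_sum_remove\<close> applies to each; \<open>t\<close> exists
    because the side \<open>T i\<close> has more than one point.\<close>
  define B where "B = insert (c i t) ((\<lambda>j. c j (k0 j)) ` {1..r})"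
  have node: "(\<Sum>k\<in>PiE {1..r} T. box_term T (b # xs) k) = 0" if b: "b \<in> B" for b
  proof -
    obtain j s where js: "b = c j s" "j \<in> {1..r}" "s \<in> T j"
      using b i t PiE_mem[OF k0] unfolding B_def by blast
    let ?T' = "T(j := T j - {s})"
    have sum: "(\<Sum>k\<in>PiE {1..r} T. box_term T (b # xs) k) = (\<Sum>k\<in>PiE {1..r} ?T'. box_term ?T' xs k)"
      unfolding js(1) by (rule box_sum_remove) (use Cons.prems(1) js in auto)
    show ?thesis
    \<comment> \<open>Deleting the only point of a side empties the box; otherwise the induction
      hypothesis applies.\<close>
    proof (cases "T j = {s}")
      case True
      then have "PiE {1..r} ?T' = {}" using js by (intro PiE_eq_empty_iff[THEN iffD2]) auto
      then show ?thesis using sum by simp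
    next
      case False
      have "card (T j) - 1 = Suc (card (?T' j) - 1)"
      proof -
        have "T j - {s} \<noteq> {}" using False js by auto
        then have "card (T j - {s}) \<noteq> 0" using Cons.prems(1)[OF js(2)] by auto
        then show ?thesis using js Cons.prems(1)[OF js(2)] by simp
      qed
      moreover have "(\<Sum>i\<in>{1..r} - {j}. card (T i) - 1) = (\<Sum>i\<in>{1..r} - {j}. card (?T' i) - 1)"
        by (intro sum.cong) auto
      ultimately have "(\<Sum>i=1..r. card (T i) - 1) = Suc (\<Sum>i=1..r. card (?T' i) - 1)"
        using js(2) by (simp only: sum.remove[of "{1..r}" j] finite_atLeastAtMost add_Suc)
      then have "(\<Sum>i=1..r. card (?T' i) - 1) = Suc (length xs)"
        using Cons.prems by simp
      then have "(\<Sum>k\<in>PiE {1..r} ?T'. box_term ?T' xs k) = 0"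
        using Cons.prems False js by (intro Cons.IH) auto
      then show ?thesis using sum by simp
    qed
  qed
  have "(\<Sum>k\<in>PiE {1..r} T. box_term T (x # xs) k)
      = (\<Sum>k\<in>PiE {1..r} T. \<Sum>b\<in>B. lagrange_coeff p 1 B x b * box_term T (b # xs) k)"
    unfolding box_term_Cons block_interpolation[OF k0m i t(2) x, folded B_def]
    by (simp add: sum_distrib_right mult.assoc)
  also have "\<dots> = (\<Sum>b\<in>B. lagrange_coeff p 1 B x b * (\<Sum>k\<in>PiE {1..r} T. box_term T (b # xs) k))"
    by (subst sum.swap) (simp add: sum_distrib_left)
  also have "\<dots> = 0" using node by simp
  finally show ?case .
qed

end

section \<open>Matrix inversion\<close>

text \<open>Let \<open>h\<close> be a column of \<open>g f - 1\<close>. Then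
  \<open>f h = (f g) f - f = 0\<close>, and since \<open>f\<close> has nonzero diagonal entries,
  triangularity forces the entries of \<open>h\<close> to vanish one after another, by induction on
  the size of the interval from \<open>l\<close> to \<open>n\<close>.\<close>

lemma left_inverse_of_right_inverse:
  fixes f g :: "'a::order \<Rightarrow> 'a \<Rightarrow> 'b::idom"
  assumes fin: "\<And>l n. l \<in> M \<Longrightarrow> n \<in> M \<Longrightarrow> finite {k. k \<in> M \<and> l \<le> k \<and> k \<le> n}"
    and fg: "\<And>l n. l \<in> M \<Longrightarrow> n \<in> M \<Longrightarrow>
      (\<Sum>k | k \<in> M \<and> l \<le> k \<and> k \<le> n. f n k * g k l) = (if n = l then 1 else 0)"
    and "l \<in> M" "n \<in> M"
  shows "(\<Sum>k | k \<in> M \<and> l \<le> k \<and> k \<le> n. g n k * f k l) = (if n = l then 1 else 0)"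
proof (cases "l \<le> n")
  case True
  define h where "h k = (\<Sum>m | m \<in> M \<and> l \<le> m \<and> m \<le> k. g k m * f m l) - (if k = l then 1 else 0)" for k
  have "h n = 0" using \<open>n \<in> M\<close> True
  proof (induction "card {k. k \<in> M \<and> l \<le> k \<and> k \<le> n}" arbitrary: n rule: less_induct)
    case less
    define I where "I = {k. k \<in> M \<and> l \<le> k \<and> k \<le> n}"
    have I: "finite I" using fin[OF \<open>l \<in> M\<close> less.prems(1)] by (simp add: I_def)
    have nI: "n \<in> I" using less.prems by (simp add: I_def)
    have zero: "h k = 0" if "k \<in> I - {n}" for k
    proof (rule less.hyps)
      show "k \<in> M" "l \<le> k" using that by (auto simp: I_def)
      have "{m. m \<in> M \<and> l \<le> m \<and> m \<le> k} \<subset> I"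
      proof
        show "{m. m \<in> M \<and> l \<le> m \<and> m \<le> k} \<subseteq> I"
          using that by (auto simp: I_def)
        have "\<not> n \<le> k" using that by (auto simp: I_def)
        then show "{m. m \<in> M \<and> l \<le> m \<and> m \<le> k} \<noteq> I" using nI by blast
      qed
      then show "card {m. m \<in> M \<and> l \<le> m \<and> m \<le> k} < card {k. k \<in> M \<and> l \<le> k \<and> k \<le> n}"
        using psubset_card_mono[OF I] by (simp add: I_def)
    qed
    have "(\<Sum>k\<in>I. f n k * h k) = (\<Sum>k\<in>I. \<Sum>m | m \<in> I \<and> m \<le> k. f n k * (g k m * f m l)) - (\<Sum>k\<in>I. f n k * (if k = l then 1 else 0))"
    proof -
      have "{m. m \<in> M \<and> l \<le> m \<and> m \<le> k} = {m. m \<in> I \<and> m \<le> k}" if "k \<in> I" for k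
        using that by (auto simp: I_def)
      then show ?thesis
        by (simp add: h_def right_diff_distrib sum_subtractf sum_distrib_left cong: sum.cong)
    qed
    also have "(\<Sum>k\<in>I. f n k * (if k = l then 1 else 0)) = f n l"
      using I less.prems \<open>l \<in> M\<close> by (simp add: if_distrib[of "(*) _"] sum.delta I_def cong: if_cong)
    also have "(\<Sum>k\<in>I. \<Sum>m | m \<in> I \<and> m \<le> k. f n k * (g k m * f m l))
        = (\<Sum>m\<in>I. \<Sum>k | k \<in> I \<and> m \<le> k. f n k * (g k m * f m l))"
      using I I by (rule sum.swap_restrict)
    also have "\<dots> = (\<Sum>m\<in>I. (if n = m then 1 else 0) * f m l)"
    proof (rule sum.cong[OF refl])
      fix m assume m: "m \<in> I"
      have "{k. k \<in> I \<and> m \<le> k} = {k. k \<in> M \<and> m \<le> k \<and> k \<le> n}"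
        using m by (auto simp: I_def)
      then have "(\<Sum>k | k \<in> I \<and> m \<le> k. f n k * (g k m * f m l)) = (\<Sum>k | k \<in> M \<and> m \<le> k \<and> k \<le> n. f n k * g k m) * f m l"
        by (simp add: sum_distrib_right mult.assoc)
      also have "\<dots> = (if n = m then 1 else 0) * f m l"
        using fg[of m n] m less.prems by (simp add: I_def)
      finally show "(\<Sum>k | k \<in> I \<and> m \<le> k. f n k * (g k m * f m l)) = (if n = m then 1 else 0) * f m l" .
    qed
    also have "\<dots> = f n l"
      using I nI by (simp add: if_distrib[of "\<lambda>x. x * _"] sum.delta cong: if_cong)
    finally have "(\<Sum>k\<in>I. f n k * h k) = 0" by simp
    moreover have "(\<Sum>k\<in>I. f n k * h k) = f n n * h n"
      using I nI zero by (simp add: sum.remove[of I n])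
    moreover have "f n n \<noteq> 0"
    proof -
      have "{k. k \<in> M \<and> n \<le> k \<and> k \<le> n} = {n}" using less.prems by auto
      then show ?thesis using fg[of n n] less.prems by auto
    qed
    ultimately show ?case by simp
  qed
  then show ?thesis by (simp add: h_def)
next
  case False
  then have empty: "{k. k \<in> M \<and> l \<le> k \<and> k \<le> n} = {}" by auto
  show ?thesis unfolding empty using False by auto
qed

section \<open>Intervals of multi-indices and products over them\<close>

lemma multi_interval_eq_PiE:
  assumes "l \<in> multi_indices r" "n \<in> multi_indices r"
  shows "{k. k \<in> multi_indices r \<and> l \<le> k \<and> k \<le> n} = PiE {1..r} (\<lambda>i. {l i..n i})"
proof
  show "{k. k \<in> multi_indices r \<and> l \<le> k \<and> k \<le> n} \<subseteq> PiE {1..r} (\<lambda>i. {l i..n i})"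
    by (auto simp: multi_indices_def PiE_iff le_fun_def extensional_def)
  show "PiE {1..r} (\<lambda>i. {l i..n i}) \<subseteq> {k. k \<in> multi_indices r \<and> l \<le> k \<and> k \<le> n}"
  proof
    fix k assume k: "k \<in> PiE {1..r} (\<lambda>i. {l i..n i})"
    have "l i \<le> k i \<and> k i \<le> n i" for i
    proof (cases "i \<in> {1..r}")
      case True
      then show ?thesis using PiE_mem[OF k] by auto
    next
      case False
      \<comment> \<open>Outside \<open>{1..r}\<close> extensional functions agree, so the order on
        functions sees the components alone.\<close>
      then have "k i = undefined" "l i = undefined" "n i = undefined"
        using k assms PiE_arb unfolding multi_indices_def by fast+
      then show ?thesis by simp
    qed
    then show "k \<in> {k. k \<in> multi_indices r \<and> l \<le> k \<and> k \<le> n}"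
      using k by (auto simp: multi_indices_def PiE_iff le_fun_def)
  qed
qed

lemma weight_mono: "k \<le> n \<Longrightarrow> weight r k \<le> weight r n"
  unfolding weight_def by (intro sum_mono) (auto simp: le_fun_def)

lemma weight_strict_mono:
  assumes "k \<in> multi_indices r" "n \<in> multi_indices r" "k \<le> n" "k \<noteq> n"
  shows "weight r k < weight r n"
proof -
  obtain i where "k i \<noteq> n i" using assms by blast
  then have "i \<in> {1..r}"
    using assms PiE_arb[of k "{1..r}" "\<lambda>_. UNIV" i] PiE_arb[of n "{1..r}" "\<lambda>_. UNIV" i]
    unfolding multi_indices_def by auto
  moreover have "k i < n i"
    using \<open>k i \<noteq> n i\<close> assms(3) by (simp add: le_fun_def order_less_le)
  ultimately show ?thesis
    unfolding weight_def using assms(3) by (intro sum_strict_mono_ex1) (auto simp: le_fun_def)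
qed

text \<open>For every position of \<open>k\<close>, endpoints included, the two ranges together
  cover \<open>{l + 1..n - 1}\<close> once and \<open>k\<close> one extra time. This surplus factor
  cancels the block at \<open>a (weight r k)\<close> in the denominator of
  \<open>g_matrix\<close>.\<close>

lemma prod_overlapping_intervals:
  fixes h :: "int \<Rightarrow> 'a::comm_monoid_mult"
  assumes "l \<le> k" "k \<le> n" "l < n"
  shows "(\<Prod>t=k..n - 1. h t) * (\<Prod>t=l + 1..k. h t) = h k * (\<Prod>t=l + 1..n - 1. h t)"
proof (cases "k = l")
  case True
  then have "{k..n - 1} = insert k {l + 1..n - 1}" using assms by auto
  then show ?thesis using True by simp
next
  case False
  then have 1: "{l + 1..k} = insert k {l + 1..k - 1}" and
    2: "{l + 1..n - 1} = {l + 1..k - 1} \<union> {k..n - 1}"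
    using assms by auto
  have "(\<Prod>t=l + 1..n - 1. h t) = (\<Prod>t=l + 1..k - 1. h t) * (\<Prod>t=k..n - 1. h t)"
    unfolding 2 by (rule prod.union_disjoint) auto
  then show ?thesis unfolding 1 by (simp add: mult_ac)
qed

section \<open>The product of the two matrices\<close>

context nonvanishing
begin

lemma denominators_mult:
  assumes "l \<le> k" "k \<le> n"
  shows "f_denom p r c n k * g_denom p r c k l
    = (\<Prod>i=1..r. \<Prod>t\<in>{l i..n i} - {k i}. theta_block p r c k (c i t))"
  unfolding f_denom_def g_denom_def prod.distrib[symmetric]
proof (rule prod.cong[OF refl])
  fix i
  have "l i \<le> k i" "k i \<le> n i" using assms by (auto simp: le_fun_def)
  then have split: "{l i..n i} - {k i} = {k i + 1..n i} \<union> {l i..k i - 1}" by auto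
  show "(\<Prod>t=k i + 1..n i. theta_block p r c k (c i t)) * (\<Prod>t=l i..k i - 1. theta_block p r c k (c i t))
    = (\<Prod>t\<in>{l i..n i} - {k i}. theta_block p r c k (c i t))"
    unfolding split by (rule prod.union_disjoint[symmetric]) auto
qed

lemma g_matrix_eq:
  assumes "l \<le> k"
  shows "g_matrix p r a c k l
    = vandermonde p r c l * theta_block p r c l (a (weight r l))
      / (vandermonde p r c k * theta_block p r c k (a (weight r k)))
      * ((\<Prod>t=weight r l + 1..weight r k. theta_block p r c k (a t)) / g_denom p r c k l)"
  using assms by (simp add: g_matrix_def vandermonde_def theta_block_def prod_dividef prod.distrib mult_ac)

lemma f_times_g:
  assumes M: "l \<in> multi_indices r" "k \<in> multi_indices r" "n \<in> multi_indices r"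
    and le: "l \<le> k" "k \<le> n" and "l \<noteq> n"
    and a: "theta_block p r c k (a (weight r k)) \<noteq> 0"
  shows "f_matrix p r a c n k * g_matrix p r a c k l
    = vandermonde p r c l * theta_block p r c l (a (weight r l))
      * box_term (\<lambda>i. {l i..n i}) (map a [weight r l + 1..weight r n - 1]) k"
proof -
  let ?b = "\<lambda>t. theta_block p r c k (a t)"
  have "weight r l \<le> weight r k" "weight r k \<le> weight r n" "weight r l < weight r n"
    using weight_mono le weight_strict_mono[OF M(1,3)] assms by (auto intro: order_trans)
  then have num: "(\<Prod>t=weight r k..weight r n - 1. ?b t) * (\<Prod>t=weight r l + 1..weight r k. ?b t)
      = ?b (weight r k) * (\<Prod>x\<leftarrow>map a [weight r l + 1..weight r n - 1]. theta_block p r c k x)"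
    using prod_overlapping_intervals[of "weight r l" "weight r k" "weight r n" ?b]
    by (simp add: o_def prod.distinct_set_conv_list[symmetric])
  have "f_matrix p r a c n k * g_matrix p r a c k l
    = vandermonde p r c l * theta_block p r c l (a (weight r l))
      * ((\<Prod>t=weight r k..weight r n - 1. ?b t) * (\<Prod>t=weight r l + 1..weight r k. ?b t))
      / (?b (weight r k) * vandermonde p r c k * (f_denom p r c n k * g_denom p r c k l))"
    unfolding g_matrix_eq[OF le(1)] using le by (simp add: f_matrix_def mult_ac)
  also have "\<dots> = vandermonde p r c l * theta_block p r c l (a (weight r l))
      * box_term (\<lambda>i. {l i..n i}) (map a [weight r l + 1..weight r n - 1]) k"
    unfolding num denominators_mult[OF le] box_term_def using a by simp
  finally show ?thesis .
qed

proposition right_inverse: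
  assumes a: "\<And>t. a t \<noteq> 0"
    and a_block: "\<And>k. k \<in> multi_indices r \<Longrightarrow> theta_block p r c k (a (weight r k)) \<noteq> 0"
    and M: "l \<in> multi_indices r" "n \<in> multi_indices r"
  shows "(\<Sum>k | k \<in> multi_indices r \<and> l \<le> k \<and> k \<le> n. f_matrix p r a c n k * g_matrix p r a c k l)
    = (if n = l then 1 else 0)"
proof (cases "n = l")
  case True
  then have "{k. k \<in> multi_indices r \<and> l \<le> k \<and> k \<le> n} = {n}" using M by auto
  then show ?thesis
    using True M vandermonde_nonzero a_block
    by (simp add: g_matrix_eq f_matrix_def f_denom_def g_denom_def)
next
  case False
  show ?thesis
  proof (cases "l \<le> n")
    case True
    \<comment> \<open>The balance required by \<open>box_sum_zero\<close>: the sides of the box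
      contribute \<open>weight r n - weight r l\<close>, and the list of numerator arguments is one
      shorter.\<close>
    have "int (\<Sum>i=1..r. card {l i..n i} - 1) = weight r n - weight r l"
      unfolding weight_def sum_subtractf[symmetric] of_nat_sum
    proof (rule sum.cong[OF refl])
      fix i
      have "l i \<le> n i" using True by (simp add: le_fun_def)
      then show "int (card {l i..n i} - 1) = n i - l i" by simp
    qed
    also have "\<dots> = int (Suc (length (map a [weight r l + 1..weight r n - 1])))"
      using weight_strict_mono[OF M True] False by simp
    finally have card: "(\<Sum>i=1..r. card {l i..n i} - 1) = Suc (length (map a [weight r l + 1..weight r n - 1]))"
      by (simp only: of_nat_eq_iff)
    have "(\<Sum>k | k \<in> multi_indices r \<and> l \<le> k \<and> k \<le> n. f_matrix p r a c n k * g_matrix p r a c k l)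
      = (\<Sum>k | k \<in> multi_indices r \<and> l \<le> k \<and> k \<le> n. vandermonde p r c l * theta_block p r c l (a (weight r l))
          * box_term (\<lambda>i. {l i..n i}) (map a [weight r l + 1..weight r n - 1]) k)"
      using M False a_block by (intro sum.cong refl f_times_g) auto
    also have "\<dots> = vandermonde p r c l * theta_block p r c l (a (weight r l))
        * (\<Sum>k\<in>PiE {1..r} (\<lambda>i. {l i..n i}). box_term (\<lambda>i. {l i..n i}) (map a [weight r l + 1..weight r n - 1]) k)"
      unfolding multi_interval_eq_PiE[OF M] by (simp add: sum_distrib_left)
    also have "(\<Sum>k\<in>PiE {1..r} (\<lambda>i. {l i..n i}). box_term (\<lambda>i. {l i..n i}) (map a [weight r l + 1..weight r n - 1]) k) = 0"
      using True a by (intro box_sum_zero card) (auto simp: le_fun_def)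
    finally show ?thesis using False by simp
  next
    case not_le: False
    then have empty: "{k. k \<in> multi_indices r \<and> l \<le> k \<and> k \<le> n} = {}" by auto
    show ?thesis unfolding empty using False by simp
  qed
qed

end

text \<open>Genericity speaks of whole products. Moving only the coordinate \<open>i\<close> of
  \<open>k\<close> to \<open>t\<close> exhibits the wanted block as a factor of
  \<open>f_denom\<close> if \<open>t\<close> lies above \<open>k i\<close>, and of
  \<open>g_denom\<close> if it lies below.\<close>

lemma generic_imp_nonvanishing:
  assumes p: "norm p < 1" and c: "\<And>j k. j \<in> {1..r} \<Longrightarrow> c j k \<noteq> 0" and gen: "generic p r a c"
  shows "nonvanishing p r c"
proof
  fix k i t
  assume k: "k \<in> multi_indices r" and i: "i \<in> {1..r}" and t: "t \<noteq> k i"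
  define n where "n = k(i := t)"
  have n: "n \<in> multi_indices r"
    using k i by (auto simp: n_def multi_indices_def PiE_iff extensional_def)
  show "theta_block p r c k (c i t) \<noteq> 0"
  proof (cases "k i < t")
    case True
    then have "k \<le> n" by (auto simp: n_def le_fun_def)
    then have "f_denom p r c n k \<noteq> 0"
      using gen k n unfolding generic_def by blast
    then have "(\<Prod>t=k i + 1..n i. theta_block p r c k (c i t)) \<noteq> 0"
      using i by (auto simp: f_denom_def)
    moreover have "t \<in> {k i + 1..n i}" using True by (simp add: n_def)
    ultimately show ?thesis by (metis finite_atLeastAtMost_int prod_zero_iff)
  next
    case False
    then have "n \<le> k" using t by (auto simp: n_def le_fun_def)
    then have "g_denom p r c k n \<noteq> 0"
      using gen k n unfolding generic_def by blast
    then have "(\<Prod>t=n i..k i - 1. theta_block p r c k (c i t)) \<noteq> 0"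
      using i by (auto simp: g_denom_def)
    moreover have "t \<in> {n i..k i - 1}" using False t by (simp add: n_def)
    ultimately show ?thesis by (metis finite_atLeastAtMost_int prod_zero_iff)
  qed
next
  fix k i j
  assume "k \<in> multi_indices r" "i \<in> {1..r}" "j \<in> {i+1..r}"
  then show "theta p (c i (k i) / c j (k j)) \<noteq> 0"
    using gen unfolding generic_def by blast
qed (use p c in auto)

theorem theorem3p1:
  fixes p :: complex and r :: nat
    and a :: "int \<Rightarrow> complex" and c :: "nat \<Rightarrow> int \<Rightarrow> complex"
  assumes "norm p < 1"
    and "r \<ge> 1"
    and "\<And>t. a t \<noteq> 0"
    and "\<And>j k. j \<in> {1..r} \<Longrightarrow> c j k \<noteq> 0"
    and "generic p r a c"
  shows "mutually_inverse r (f_matrix p r a c) (g_matrix p r a c)"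
proof -
  interpret nonvanishing p r c
    using assms by (intro generic_imp_nonvanishing) auto
  have a_block: "theta_block p r c k (a (weight r k)) \<noteq> 0" if "k \<in> multi_indices r" for k
    using assms(5) that unfolding generic_def theta_block_def by auto
  note inv = right_inverse[OF assms(3) a_block]
  have fin: "finite {k. k \<in> multi_indices r \<and> l \<le> k \<and> k \<le> n}"
    if "l \<in> multi_indices r" "n \<in> multi_indices r" for l n
    unfolding multi_interval_eq_PiE[OF that] by (intro finite_PiE) auto
  show ?thesis
    unfolding mutually_inverse_def
  proof (intro conjI ballI)
    show "lower_triangular r (f_matrix p r a c)" "lower_triangular r (g_matrix p r a c)"
      by (auto simp: lower_triangular_def f_matrix_def g_matrix_def)
    fix n l assume nl: "n \<in> multi_indices r" "l \<in> multi_indices r"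
    show "(\<Sum>k | k \<in> multi_indices r \<and> l \<le> k \<and> k \<le> n. f_matrix p r a c n k * g_matrix p r a c k l)
        = (if n = l then 1 else 0)"
      using nl by (intro inv)
    show "(\<Sum>k | k \<in> multi_indices r \<and> l \<le> k \<and> k \<le> n. g_matrix p r a c n k * f_matrix p r a c k l)
        = (if n = l then 1 else 0)"
      using nl by (intro left_inverse_of_right_inverse[OF fin inv])
  qed
qed

end
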